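(* Let $t>0$ and let $\xi$ be a stationary marked random connection model on $\mathbb{R}^d\times\mathbb{M}$ based on a Poisson process with intensity measure $t\,\lambda_d\otimes\mathbb{Q}$. Then $\xi$ is irreducible if and only if $$\sup_{n\ge 1} d_\varphi^{(n)}(p,q)>0,\qquad \text{for } \mathbb{Q}^2\text{-a.e. }(p,q)\in\mathbb{M}^2 .$$
   Context: Stationary marked random connection model (RCM). $\mathbb{M}$ is a complete separable metric space with a Borel probability measure $\mathbb{Q}$, $\mathbb{X}=\mathbb{R}^d\times\mathbb{M}$ ($d\ge1$), $\lambda_d$ is Lebesgue measure and $\lambda=\lambda_d\otimes\mathbb{Q}$. The connection function $\varphi\colon\mathbb{X}^2\to[0,1]$ is measurable, symmetric, and satisfies $\varphi((x,p),(y,q))=\varphi((0,p),(y-x,q))$; one writes $\varphi(x,p,q):=\varphi((0,p),(x,q))$ and assumes $\iint\varphi(x,p,q)\,dx\,\mathbb{Q}^2(d(p,q))<\infty$. $\eta$ is a Poisson process on $\mathbb{X}$ with intensity measure $t\lambda$, and $\xi$ is the random graph with vertex set $\eta$ in which, given $\eta$, each pair of distinct points $(x,p),(y,q)\in\eta$ is joined by an edge with probability $\varphi((x,p),(y,q))$, independently for different pairs. For $z_1,z_2\in\mathbb{X}$, $\xi^{z_1,z_2}$ is the RCM based on $\eta+\delta_{z_1}+\delta_{z_2}$. $\xi$ is irreducible if $\mathbb{P}(z_1\leftrightarrow z_2\text{ in }\xi^{z_1,z_2})>0$ for $\lambda^2$-a.e. $(z_1,z_2)\in\mathbb{X}^2$,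 where $\leftrightarrow$ denotes connection by a path. Define $\varphi^{(1)}:=\varphi$ and $\varphi^{(n+1)}(z_1,z_2):=\int\varphi^{(n)}(z_1,z)\varphi(z,z_2)\,\lambda(dz)$ for $z_1,z_2\in\mathbb{X}$, $n\in\mathbb{N}$; write $\varphi^{(n)}(x,p,q):=\varphi^{(n)}((0,p),(x,q))$, and $$d_\varphi^{(n)}(p,q):=\int_{\mathbb{R}^d}\varphi^{(n)}(x,p,q)\,dx\in[0,\infty],\qquad p,q\in\mathbb{M}.$$ *)

theory Defs
  imports "HOL-Probability.Probability"
begin

text \<open>
  Points of \<open>\<real>\<^sup>d \<times> \<M>\<close> are pairs in \<open>(real ^ 'd) \<times> 'm\<close> with \<open>d = CARD('d)\<close>;
  the mark space is the complete separable metric space \<open>'m\<close>.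
\<close>

subsection \<open>Connection functions and their convolution powers\<close>

abbreviation marked_lebesgue :: "'m::polish_space measure \<Rightarrow> ((real ^ 'd) \<times> 'm) measure" where
  "marked_lebesgue Q \<equiv> lborel \<Otimes>\<^sub>M Q"

definition connection_function ::
    "'m::polish_space measure \<Rightarrow> ((real ^ 'd) \<times> 'm \<Rightarrow> (real ^ 'd) \<times> 'm \<Rightarrow> real) \<Rightarrow> bool" where
  "connection_function Q \<phi> \<longleftrightarrow>
     (\<forall>z w. 0 \<le> \<phi> z w \<and> \<phi> z w \<le> 1) \<and>
     (\<lambda>(z, w). \<phi> z w) \<in> borel_measurable borel \<and>
     (\<forall>z w. \<phi> z w = \<phi> w z) \<and>
     (\<forall>x p y q. \<phi> (x, p) (y, q) = \<phi> (0, p) (y - x, q)) \<and>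
     (\<integral>\<^sup>+(p, q). (\<integral>\<^sup>+x. ennreal (\<phi> (0, p) (x, q)) \<partial>lborel) \<partial>(Q \<Otimes>\<^sub>M Q)) < \<infinity>"

text \<open>The powers are indexed from 1; the value at index 0 is a dummy.\<close>

fun conn_pow ::
    "'m::polish_space measure \<Rightarrow> ((real ^ 'd) \<times> 'm \<Rightarrow> (real ^ 'd) \<times> 'm \<Rightarrow> real) \<Rightarrow>
     nat \<Rightarrow> (real ^ 'd) \<times> 'm \<Rightarrow> (real ^ 'd) \<times> 'm \<Rightarrow> ennreal" where
  "conn_pow Q \<phi> 0 z1 z2 = 0"
| "conn_pow Q \<phi> (Suc 0) z1 z2 = ennreal (\<phi> z1 z2)"
| "conn_pow Q \<phi> (Suc (Suc n)) z1 z2 =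
     (\<integral>\<^sup>+z. conn_pow Q \<phi> (Suc n) z1 z * ennreal (\<phi> z z2) \<partial>marked_lebesgue Q)"

definition d_conn ::
    "'m::polish_space measure \<Rightarrow> ((real ^ 'd) \<times> 'm \<Rightarrow> (real ^ 'd) \<times> 'm \<Rightarrow> real) \<Rightarrow>
     nat \<Rightarrow> 'm \<Rightarrow> 'm \<Rightarrow> ennreal" where
  "d_conn Q \<phi> n p q = (\<integral>\<^sup>+x. conn_pow Q \<phi> n (0, p) (x, q) \<partial>lborel)"

subsection \<open>Poisson processes\<close>

text \<open>The counting measure \<open>\<Sum>\<^sub>i \<delta>\<^bsub>X i \<omega>\<^esub>\<close>.\<close>

definition dirac_sum :: "(nat \<Rightarrow> 'w \<Rightarrow> 'a::topological_space) \<Rightarrow> 'w \<Rightarrow> 'a measure" where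
  "dirac_sum X \<omega> = distr (count_space UNIV) borel (\<lambda>i. X i \<omega>)"

definition poisson_process :: "'w measure \<Rightarrow> 'a measure \<Rightarrow> ('w \<Rightarrow> 'a measure) \<Rightarrow> bool" where
  "poisson_process P \<mu> \<eta> \<longleftrightarrow>
     (\<forall>\<omega>\<in>space P. sets (\<eta> \<omega>) = sets \<mu> \<and>
        (\<forall>A\<in>sets \<mu>. emeasure (\<eta> \<omega>) A \<in> insert \<infinity> (range of_nat))) \<and>
     (\<forall>A\<in>sets \<mu>. (\<lambda>\<omega>. emeasure (\<eta> \<omega>) A) \<in> borel_measurable P) \<and>
     (\<forall>A\<in>sets \<mu>. emeasure \<mu> A < \<infinity> \<longrightarrow>
        (\<forall>k::nat. measure P {\<omega>\<in>space P. emeasure (\<eta> \<omega>) A = of_nat k} =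
           measure \<mu> A ^ k / fact k * exp (- measure \<mu> A))) \<and>
     (\<forall>A\<in>sets \<mu>. emeasure \<mu> A = \<infinity> \<longrightarrow> (AE \<omega> in P. emeasure (\<eta> \<omega>) A = \<infinity>)) \<and>
     (\<forall>(n::nat) A. (\<forall>i<n. A i \<in> sets \<mu>) \<and> disjoint_family_on A {..<n} \<longrightarrow>
        prob_space.indep_vars P (\<lambda>_. borel) (\<lambda>i \<omega>. emeasure (\<eta> \<omega>) (A i)) {..<n})"

subsection \<open>Random connection models\<close>

text \<open>
  \<open>\<xi> \<omega>\<close> is the edge set of a simple undirected graph whose vertices are the points
  \<open>Y 0 \<omega>, Y 1 \<omega>, \<dots>\<close>. Given the points, each pair \<open>i < j\<close> is joined with probability
  \<open>\<phi> (Y i) (Y j)\<close>, independently for different pairs: the last clause gives the conditional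
  probability that, among any finite set \<open>F\<close> of pairs, exactly those in \<open>K\<close> are joined.
  Different indices stand for different vertices, so the definition is meant for enumerations that
  are almost surely injective, as holds for a Poisson process with diffuse intensity measure, also
  after adding two fixed distinct points.
\<close>

definition random_connection_model ::
    "'w measure \<Rightarrow> ('a::topological_space \<Rightarrow> 'a \<Rightarrow> real) \<Rightarrow> (nat \<Rightarrow> 'w \<Rightarrow> 'a) \<Rightarrow>
     ('w \<Rightarrow> ('a \<times> 'a) set) \<Rightarrow> bool" where
  "random_connection_model P \<phi> Y \<xi> \<longleftrightarrow>
     (\<forall>i. Y i \<in> P \<rightarrow>\<^sub>M borel) \<and>
     (\<forall>\<omega>\<in>space P. sym (\<xi> \<omega>) \<and> irrefl (\<xi> \<omega>) \<and>
        \<xi> \<omega> \<subseteq> range (\<lambda>i. Y i \<omega>) \<times> range (\<lambda>i. Y i \<omega>)) \<and>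
     (\<forall>i j. {\<omega>\<in>space P. (Y i \<omega>, Y j \<omega>) \<in> \<xi> \<omega>} \<in> sets P) \<and>
     (\<forall>F K. finite F \<and> F \<subseteq> {(i, j). i < j} \<and> K \<subseteq> F \<longrightarrow>
        (AE \<omega> in P.
           real_cond_exp P
             (vimage_algebra (space P) (\<lambda>\<omega> i. Y i \<omega>) (\<Pi>\<^sub>M i\<in>UNIV. borel))
             (indicator {\<omega>\<in>space P. \<forall>(i, j)\<in>F. (Y i \<omega>, Y j \<omega>) \<in> \<xi> \<omega> \<longleftrightarrow> (i, j) \<in> K}) \<omega>
           = (\<Prod>(i, j)\<in>K. \<phi> (Y i \<omega>) (Y j \<omega>)) *
             (\<Prod>(i, j)\<in>F - K. 1 - \<phi> (Y i \<omega>) (Y j \<omega>))))"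

text \<open>The points of \<open>\<eta> + \<delta>\<^bsub>z1\<^esub> + \<delta>\<^bsub>z2\<^esub>\<close>, where \<open>\<eta>\<close> has the points \<open>X 0, X 1, \<dots>\<close>.\<close>

definition add_points :: "'a \<Rightarrow> 'a \<Rightarrow> (nat \<Rightarrow> 'w \<Rightarrow> 'a) \<Rightarrow> nat \<Rightarrow> 'w \<Rightarrow> 'a" where
  "add_points z1 z2 X = case_nat (\<lambda>_. z1) (case_nat (\<lambda>_. z2) X)"

text \<open>
  \<open>X\<close> enumerates the Poisson process \<open>\<eta>\<close>, \<open>\<xi>\<close> is the RCM based on \<open>\<eta>\<close>, and \<open>\<Xi> z1 z2\<close> is the
  RCM based on \<open>\<eta> + \<delta>\<^bsub>z1\<^esub> + \<delta>\<^bsub>z2\<^esub>\<close>. Enumerating by all of \<open>nat\<close> loses nothing, since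
  \<open>\<eta>\<close> almost surely has infinitely many points. The joint law of the graphs \<open>\<xi>\<close> and
  \<open>\<Xi> z1 z2\<close> is left open. The case \<open>z1 = z2\<close> (a null set of pairs) is excluded because then the
  points are not distinct.
\<close>

definition stationary_marked_rcm ::
    "'w measure \<Rightarrow> real \<Rightarrow> 'm::polish_space measure \<Rightarrow>
     ((real ^ 'd) \<times> 'm \<Rightarrow> (real ^ 'd) \<times> 'm \<Rightarrow> real) \<Rightarrow>
     (nat \<Rightarrow> 'w \<Rightarrow> (real ^ 'd) \<times> 'm) \<Rightarrow>
     ('w \<Rightarrow> (((real ^ 'd) \<times> 'm) \<times> ((real ^ 'd) \<times> 'm)) set) \<Rightarrow>
     ((real ^ 'd) \<times> 'm \<Rightarrow> (real ^ 'd) \<times> 'm \<Rightarrow>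
        'w \<Rightarrow> (((real ^ 'd) \<times> 'm) \<times> ((real ^ 'd) \<times> 'm)) set) \<Rightarrow> bool" where
  "stationary_marked_rcm P t Q \<phi> X \<xi> \<Xi> \<longleftrightarrow>
     prob_space P \<and>
     prob_space Q \<and> sets Q = sets borel \<and>
     connection_function Q \<phi> \<and>
     poisson_process P (scale_measure (ennreal t) (marked_lebesgue Q)) (dirac_sum X) \<and>
     random_connection_model P \<phi> X \<xi> \<and>
     (\<forall>z1 z2. z1 \<noteq> z2 \<longrightarrow> random_connection_model P \<phi> (add_points z1 z2 X) (\<Xi> z1 z2))"

definition irreducible_rcm ::
    "'w measure \<Rightarrow> 'm::polish_space measure \<Rightarrow>
     ((real ^ 'd) \<times> 'm \<Rightarrow> (real ^ 'd) \<times> 'm \<Rightarrow>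
        'w \<Rightarrow> (((real ^ 'd) \<times> 'm) \<times> ((real ^ 'd) \<times> 'm)) set) \<Rightarrow> bool" where
  "irreducible_rcm P Q \<Xi> \<longleftrightarrow>
     (AE (z1, z2) in marked_lebesgue Q \<Otimes>\<^sub>M marked_lebesgue Q.
        measure P {\<omega>\<in>space P. (z1, z2) \<in> (\<Xi> z1 z2 \<omega>)\<^sup>*} > 0)"

end

theory Submission
  imports Defs
begin

text \<open>
  Call two points \<open>z\<close> and \<open>w\<close> of \<open>\<real>\<^sup>d \<times> \<M>\<close> linked if \<open>\<phi>\<^bsup>(n)\<^esup>(z, w) > 0\<close> for some \<open>n \<ge> 1\<close>. The
  equivalence is proved in two steps, one probabilistic and one analytic, with the statement
  ``almost every pair is linked'' in the middle.

  \<^item> Points \<open>z1 \<noteq> z2\<close> are linked if and only if they are connected with positive probability after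
    being added to the Poisson process. Only null sets matter here, so the multivariate Mecke
    equation is replaced by its qualitative form (\<open>distinct_tuples_null_iff\<close>): a set of \<open>k\<close>-tuples
    with distinct entries is null for the \<open>k\<close>-th power of the intensity measure if and only if
    almost surely no \<open>k\<close> points of the process form such a tuple. If \<open>\<phi>\<^bsup>(k+1)\<^esup>(z1, z2) > 0\<close>, then
    \<open>k\<close> points along which every factor \<open>\<phi>\<close> is positive occur with positive probability, and given the
    points the edges between them are all present with positive probability
    (\<open>connected_if_linked\<close>). If \<open>z1\<close> and \<open>z2\<close> are not linked, then almost surely no edge leaves the
    points linked to \<open>z1\<close>, and these are not joined to \<open>z2\<close> (\<open>disconnected_if_unlinked\<close>).

  \<^item> Since \<open>\<phi>\<^bsup>(n)\<^esup>\<close> is stationary, \<open>sup\<^sub>n d\<^bsup>(n)\<^esup>(p, q) > 0\<close> says that \<open>(0, p)\<close> is linked to \<open>(x, q)\<close> for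
    a set of \<open>x\<close> of positive Lebesgue measure. The point is to pass from positive measure to
    full measure (\<open>invariant_relation_full\<close>). By the Chapman-Kolmogorov equation, linkedness is
    transitive up to null sets, so if two typical points \<open>(x, p)\<close> and \<open>(y, r)\<close> are linked, then they
    are linked to the same points up to a null set. For fixed typical marks \<open>p\<close>, \<open>r\<close>, \<open>q\<close> let \<open>B\<close> be the
    set of positions \<open>v\<close> with \<open>(v, q)\<close> linked to \<open>(x, p)\<close>. As \<open>y\<close> runs through a set of positive measure,
    \<open>B\<close> agrees up to null sets with the translate \<open>D + y\<close> of a fixed set \<open>D\<close>, so the translations that
    leave \<open>B\<close> unchanged up to null sets form a group containing all differences of such \<open>y\<close>. By
    Steinhaus' theorem this group is \<open>\<real>\<^sup>d\<close>, and hence \<open>B\<close>, which is not null, has full measure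
    (\<open>shift_dichotomy\<close>).
\<close>

section \<open>Translates of sets of positive Lebesgue measure\<close>

lemma AE_lborel_shift:
  fixes P :: "'a::euclidean_space \<Rightarrow> bool"
  assumes "AE x in lborel. P x"
  shows "AE x in lborel. P (x + c)"
proof -
  have "AE x in distr lborel borel ((+) c). P x"
    unfolding lborel_distr_plus by (rule assms)
  then have "AE x in lborel. P (c + x)"
    by (rule AE_distrD[rotated]) simp
  then show ?thesis
    by (simp add: add.commute)
qed

text \<open>
  A compact part \<open>T\<close> of \<open>A\<close> has an open neighbourhood \<open>U\<close> with less than twice its measure. A
  translate of \<open>T\<close> by less than the distance from \<open>T\<close> to the complement of \<open>U\<close> stays in \<open>U\<close>, so
  there is no room for it to be disjoint from \<open>T\<close>.
\<close>

lemma steinhaus: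
  fixes A :: "'a::euclidean_space set"
  assumes A: "A \<in> sets borel" and pos: "emeasure lborel A > 0"
  shows "\<exists>\<delta>>0. \<forall>v. norm v < \<delta> \<longrightarrow> (\<exists>x\<in>A. \<exists>y\<in>A. x - y = v)"
proof -
  \<comment> \<open>The part of \<open>A\<close> in a large ball still has positive measure, and there measures are finite.\<close>
  have "\<exists>n. emeasure lborel (A \<inter> cball 0 (real n)) \<noteq> 0"
  proof (rule ccontr)
    assume "\<not> ?thesis"
    then have "(\<Union>n. A \<inter> cball 0 (real n)) \<in> null_sets lborel"
      using A by (intro null_sets_UN) (auto intro!: null_setsI)
    moreover have "(\<Union>n. A \<inter> cball 0 (real n)) = A"
      by (auto simp: real_arch_simple)
    ultimately show False using pos by auto
  qed
  then obtain n where n: "emeasure lborel (A \<inter> cball 0 (real n)) \<noteq> 0" by auto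
  define B where "B = A \<inter> cball 0 (real n)"
  have Bb: "B \<in> sets borel" "bounded B"
    using A by (auto simp: B_def intro: bounded_subset[OF bounded_cball])
  have Bl: "B \<in> lmeasurable"
    using Bb by (intro bounded_set_imp_lmeasurable) auto
  have Bpos: "0 < measure lebesgue B"
  proof -
    have "emeasure lebesgue B = emeasure lborel B"
      using Bb(1) by simp
    then have "ennreal (measure lebesgue B) \<noteq> 0"
      using n Bl unfolding B_def[symmetric] by (simp add: emeasure_eq_measure2)
    then show ?thesis by (simp add: less_le)
  qed
  obtain T where T: "closed T" "T \<subseteq> B" "B - T \<in> lmeasurable" "measure lebesgue (B - T) < measure lebesgue B"
  proof -
    obtain T where T: "closed T" "T \<subseteq> B" "B - T \<in> lmeasurable"
      "emeasure lebesgue (B - T) < ennreal (measure lebesgue B)"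
      using sets_lebesgue_inner_closed[OF fmeasurableD[OF Bl] Bpos] by blast
    then show ?thesis using that by (simp add: emeasure_eq_measure2 ennreal_less_iff)
  qed
  have Tc: "compact T" using T Bb by (meson bounded_subset compact_eq_bounded_closed)
  have Tl: "T \<in> lmeasurable" using Tc by (rule lmeasurable_compact)
  have "measure lebesgue (B - T) = measure lebesgue B - measure lebesgue T"
    using T(2) Bl Tl by (simp add: measurable_measure_Diff fmeasurableD)
  then have Tpos: "0 < measure lebesgue T" using T(4) by simp
  obtain U where U: "open U" "T \<subseteq> U" "U - T \<in> lmeasurable" "measure lebesgue (U - T) < measure lebesgue T"
  proof -
    obtain U where U: "open U" "T \<subseteq> U" "U - T \<in> lmeasurable"
      "emeasure lebesgue (U - T) < ennreal (measure lebesgue T)"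
      using sets_lebesgue_outer_open[OF fmeasurableD[OF Tl] Tpos] by blast
    then show ?thesis using that by (simp add: emeasure_eq_measure2 ennreal_less_iff)
  qed
  have Ul: "U \<in> lmeasurable"
    using U(3) Tl U(2) by (metis Diff_partition fmeasurable.Un)
  have "measure lebesgue (U - T) = measure lebesgue U - measure lebesgue T"
    using U(2) Ul Tl by (simp add: measurable_measure_Diff fmeasurableD)
  then have Um: "measure lebesgue U < 2 * measure lebesgue T" using U(4) by simp
  obtain d where d: "d > 0" "\<forall>x\<in>T. \<forall>y\<in>-U. d \<le> dist x y"
    using separate_compact_closed[of T "-U"] Tc U by auto
  show ?thesis
  proof (intro exI[of _ d] conjI allI impI d(1))
    fix v :: 'a assume v: "norm v < d"
    have sub: "(+) v ` T \<subseteq> U"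
    proof
      fix y assume "y \<in> (+) v ` T"
      then obtain x where x: "x \<in> T" "y = v + x" by auto
      have "dist x y < d" using v x by (simp add: dist_norm)
      then show "y \<in> U" using d(2) x(1) by force
    qed
    have "T \<inter> (+) v ` T \<noteq> {}"
    proof
      assume disj: "T \<inter> (+) v ` T = {}"
      have Tv: "(+) v ` T \<in> lmeasurable" using Tl by (rule measurable_translation)
      have "measure lebesgue (T \<union> (+) v ` T) = measure lebesgue T + measure lebesgue ((+) v ` T)"
        using disj Tl Tv by (simp add: measure_Un3)
      also have "\<dots> = 2 * measure lebesgue T" by (simp add: measure_translation)
      finally have "2 * measure lebesgue T \<le> measure lebesgue U"
        using sub U(2) Ul Tl Tv by (metis Un_least fmeasurable.Un fmeasurableD measure_mono_fmeasurable)
      then show False using Um by simp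
    qed
    then obtain x y where "x \<in> T" "y \<in> T" "x = v + y" by auto
    then show "\<exists>x\<in>A. \<exists>y\<in>A. x - y = v"
      using T(2) by (intro bexI[of _ x] bexI[of _ y]) (auto simp: B_def)
  qed
qed

text \<open>
  The translations preserving \<open>B\<close> up to null sets form a group; by Steinhaus' theorem it contains a
  ball, hence everything. A set with this invariance is null or has null complement.
\<close>

lemma shift_dichotomy:
  fixes A B D :: "'a::euclidean_space set"
  assumes [measurable]: "A \<in> sets borel" "B \<in> sets borel"
    and A: "\<not> (AE y in lborel. y \<notin> A)" and B: "\<not> (AE v in lborel. v \<notin> B)"
    and AB: "AE y in lborel. y \<in> A \<longrightarrow> (AE v in lborel. v - y \<in> D \<longleftrightarrow> v \<in> B)"
  shows "AE v in lborel. v \<in> B"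
proof -
  obtain N where N: "N \<in> null_sets lborel"
    "\<And>y. y \<notin> N \<Longrightarrow> y \<in> A \<longrightarrow> (AE v in lborel. v - y \<in> D \<longleftrightarrow> v \<in> B)"
    using AB by (auto elim!: AE_E3)
  have "emeasure lborel (A - N) = emeasure lborel A"
    using N(1) by (intro emeasure_Diff_null_set) auto
  moreover have "emeasure lborel A \<noteq> 0"
    using A AE_iff_null_sets[of A lborel] by (auto simp: null_sets_def)
  ultimately have "emeasure lborel (A - N) > 0" by (simp add: zero_less_iff_neq_zero)
  moreover have "A - N \<in> sets borel" using N(1) by (auto dest: null_setsD2)
  ultimately obtain \<delta> where \<delta>: "\<delta> > 0"
    "\<And>v. norm v < \<delta> \<Longrightarrow> \<exists>x\<in>A - N. \<exists>y\<in>A - N. x - y = v"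
    using steinhaus[of "A - N"] by blast
  define H where "H = {h. AE v in lborel. v + h \<in> B \<longleftrightarrow> v \<in> B}"
  have small: "h \<in> H" if hn: "norm h < \<delta>" for h
  proof -
    obtain x y where xy: "x \<in> A - N" "y \<in> A - N" "x - y = h" using \<delta>(2)[OF hn] by auto
    have y: "AE v in lborel. v - y \<in> D \<longleftrightarrow> v \<in> B" using N(2)[of y] xy by auto
    have "AE v in lborel. v - x \<in> D \<longleftrightarrow> v \<in> B" using N(2)[of x] xy by auto
    from AE_lborel_shift[OF this, of h] have "AE v in lborel. v + h - x \<in> D \<longleftrightarrow> v + h \<in> B" .
    moreover have "v + h - x = v - y" for v unfolding xy(3)[symmetric] by simp
    ultimately have "AE v in lborel. v - y \<in> D \<longleftrightarrow> v + h \<in> B" by (simp only:)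
    with y have "AE v in lborel. v + h \<in> B \<longleftrightarrow> v \<in> B" by eventually_elim simp
    then show ?thesis by (simp add: H_def)
  qed
  have add: "h + k \<in> H" if "h \<in> H" "k \<in> H" for h k
  proof -
    have "AE v in lborel. v + h + k \<in> B \<longleftrightarrow> v + h \<in> B"
      using that(2) unfolding H_def by (intro AE_lborel_shift) simp
    moreover have "AE v in lborel. v + h \<in> B \<longleftrightarrow> v \<in> B" using that(1) by (simp add: H_def)
    ultimately have "AE v in lborel. v + (h + k) \<in> B \<longleftrightarrow> v \<in> B"
      by eventually_elim (simp add: add.assoc)
    then show ?thesis by (simp add: H_def)
  qed
  have mult: "real n *\<^sub>R h \<in> H" if "h \<in> H" for h n
  proof (induction n)
    case 0
    show ?case by (simp add: H_def)
  next
    case (Suc n)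
    then show ?case using add[OF that Suc] by (simp add: algebra_simps)
  qed
  have all: "h \<in> H" for h
  proof -
    obtain n :: nat where n: "norm h / \<delta> < real n" using reals_Archimedean2 by blast
    then have "n > 0" using \<delta>(1) by (cases n) (auto simp: divide_less_0_iff not_less)
    then have "norm ((1 / real n) *\<^sub>R h) < \<delta>" using n \<delta>(1) by (simp add: field_simps)
    from mult[OF small[OF this], of n] show ?thesis using \<open>n > 0\<close> by simp
  qed
  \<comment> \<open>Exchanging the order, some \<open>v\<close> in \<open>B\<close> has almost all of its translates in \<open>B\<close>.\<close>
  have "AE h in lborel. AE v in lborel. v + h \<in> B \<longleftrightarrow> v \<in> B" using all by (auto simp: H_def)
  moreover have "Measurable.pred (lborel \<Otimes>\<^sub>M lborel) (\<lambda>u. snd u + fst u \<in> B \<longleftrightarrow> snd u \<in> B)"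
    by measurable
  ultimately have "AE v in lborel. AE h in lborel. v + h \<in> B \<longleftrightarrow> v \<in> B"
    by (subst (asm) lborel_pair.AE_commute) (simp_all add: pred_def)
  then obtain v where v: "v \<in> B" "AE h in lborel. v + h \<in> B \<longleftrightarrow> v \<in> B"
    using B by (metis (mono_tags, lifting) eventually_mono)
  have "AE h in lborel. v + (h + (- v)) \<in> B \<longleftrightarrow> v \<in> B"
    using v(2) by (rule AE_lborel_shift)
  then show ?thesis using v(1) by simp
qed

section \<open>Translation-invariant relations that are transitive up to null sets\<close>

text \<open>
  This makes statements with nested almost-everywhere quantifiers measurable, so that the quantifiers
  can be exchanged.
\<close>

lemma (in sigma_finite_measure) pred_AE:
  assumes [measurable]: "Measurable.pred (N \<Otimes>\<^sub>M M) (\<lambda>(x, y). P x y)"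
  shows "Measurable.pred N (\<lambda>x. AE y in M. P x y)"
proof -
  have "Measurable.pred N (\<lambda>x. (\<integral>\<^sup>+y. (if P x y then 0 else 1) \<partial>M) = 0)"
    by measurable
  moreover have "(\<integral>\<^sup>+y. (if P x y then 0 else 1) \<partial>M) = 0 \<longleftrightarrow> (AE y in M. P x y)"
    if [simp, measurable]: "x \<in> space N" for x
  proof -
    have [measurable]: "Measurable.pred M (\<lambda>y. P x y)"
      using measurable_compose[OF measurable_Pair1'[OF that] assms] by simp
    have "(\<integral>\<^sup>+y. (if P x y then 0 else 1) \<partial>M) = 0 \<longleftrightarrow> (AE y in M. (if P x y then 0 else 1::ennreal) = 0)"
      by (intro nn_integral_0_iff_AE) measurable
    also have "\<dots> \<longleftrightarrow> (AE y in M. P x y)"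
      by (intro AE_cong) auto
    finally show ?thesis .
  qed
  ultimately show ?thesis
    by (simp cong: measurable_cong)
qed

lemma (in pair_sigma_finite) AE_pair_swapped:
  assumes "AE u in M1 \<Otimes>\<^sub>M M2. P u"
  shows "AE r in M2. AE y in M1. P (y, r)"
proof -
  interpret Q: pair_sigma_finite M2 M1 ..
  have "AE u in M2 \<Otimes>\<^sub>M M1. P (case u of (x, y) \<Rightarrow> (y, x))"
    using assms by (subst (asm) distr_pair_swap) (rule AE_distrD[rotated], auto)
  from Q.AE_pair[OF this] show ?thesis by simp
qed

lemma (in pair_sigma_finite) AE_pair_measure_swapped:
  assumes [measurable]: "Measurable.pred (M1 \<Otimes>\<^sub>M M2) P"
    and ae: "AE r in M2. AE y in M1. P (y, r)"
  shows "AE u in M1 \<Otimes>\<^sub>M M2. P u"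
proof (rule AE_pair_measure)
  show "AE y in M1. AE r in M2. P (y, r)"
    using ae by (subst AE_commute) auto
qed auto

lemma AE_lborel_ex:
  fixes P :: "'a::euclidean_space \<Rightarrow> bool"
  assumes "AE x in lborel. P x" shows "\<exists>x. P x"
proof (rule ccontr)
  assume "\<nexists>x. P x"
  then have "AE x::'a in lborel. False" using assms by simp
  then show False by (simp add: AE_iff_measurable[OF _ refl])
qed

text \<open>
  Transitivity up to null sets and symmetry together make the neighbourhoods of almost all pairs of
  related points agree up to null sets. For fixed marks this is the situation of \<open>shift_dichotomy\<close>,
  which turns slices of positive measure into slices of full measure.
\<close>

lemma invariant_relation_full:
  fixes c :: "'a::euclidean_space \<times> 'm \<Rightarrow> 'a \<times> 'm \<Rightarrow> bool"
  assumes "prob_space Q"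
    and meas: "Measurable.pred ((lborel \<Otimes>\<^sub>M Q) \<Otimes>\<^sub>M (lborel \<Otimes>\<^sub>M Q)) (\<lambda>(z, w). c z w)"
    and sym: "\<And>z w. c z w \<longleftrightarrow> c w z"
    and shift: "\<And>x p y q. c (x, p) (y, q) \<longleftrightarrow> c (0, p) (y - x, q)"
    and comp: "\<And>z w. AE u in lborel \<Otimes>\<^sub>M Q. c z u \<and> c u w \<longrightarrow> c z w"
    and nonnull: "AE (p, q) in Q \<Otimes>\<^sub>M Q. \<not> (AE x in lborel. \<not> c (0, p) (x, q))"
  shows "AE (z, w) in (lborel \<Otimes>\<^sub>M Q) \<Otimes>\<^sub>M (lborel \<Otimes>\<^sub>M Q). c z w"
proof -
  interpret Q: prob_space Q by fact
  interpret Lb: pair_sigma_finite "lborel :: 'a measure" Q ..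
  define L where "L = (lborel :: 'a measure) \<Otimes>\<^sub>M Q"
  interpret L: sigma_finite_measure L unfolding L_def by (rule Lb.sigma_finite_measure_axioms)
  interpret LL: pair_sigma_finite L L ..
  interpret QQ: pair_sigma_finite Q Q ..
  note meas' = meas[folded L_def]
  have mc [measurable (raw)]: "Measurable.pred M (\<lambda>s. c (f s) (g s))"
    if [measurable]: "f \<in> M \<rightarrow>\<^sub>M L" "g \<in> M \<rightarrow>\<^sub>M L" for M :: "'s measure" and f g
    using measurable_compose[OF measurable_Pair[OF that] meas'] by simp
  have meas_AE [measurable (raw)]: "Measurable.pred N (\<lambda>s. AE w in L. R s w)"
    if "Measurable.pred (N \<Otimes>\<^sub>M L) (\<lambda>(s, w). R s w)" for N :: "'s measure" and R
    using that by (rule L.pred_AE)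
  have compL: "AE u in L. c z u \<and> c u w \<longrightarrow> c z w" for z w
    using comp unfolding L_def .
  have right: "AE u in L. AE w in L. c z u \<and> c u w \<longrightarrow> c z w" if [measurable]: "z \<in> space L" for z
  proof (subst LL.AE_commute)
    show "{x \<in> space (L \<Otimes>\<^sub>M L). c z (fst x) \<and> c (fst x) (snd x) \<longrightarrow> c z (snd x)} \<in> sets (L \<Otimes>\<^sub>M L)"
      by measurable
    show "AE w in L. AE u in L. c z u \<and> c u w \<longrightarrow> c z w"
      by (rule AE_I2) (rule compL)
  qed
  have left: "AE z in L. AE u in L. AE w in L. c u z \<and> c z w \<longrightarrow> c u w"
  proof (rule LL.AE_commute[THEN iffD1])
    show "{x \<in> space (L \<Otimes>\<^sub>M L). AE w in L. c (fst x) (snd x) \<and> c (snd x) w \<longrightarrow> c (fst x) w} \<in> sets (L \<Otimes>\<^sub>M L)"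
      by measurable
    show "AE u in L. AE z in L. AE w in L. c u z \<and> c z w \<longrightarrow> c u w"
      by (rule AE_I2) (rule right)
  qed
  have "AE z in L. AE u in L. AE w in L. c z u \<longrightarrow> (c u w \<longleftrightarrow> c z w)"
    using left AE_space
  proof eventually_elim
    case (elim z)
    show ?case
      using right[OF elim(2)] elim(1)
    proof eventually_elim
      case (elim u)
      then show ?case by eventually_elim (use sym in blast)
    qed
  qed
  then have "AE x in lborel. AE p in Q. AE u in L. AE w in L. c (x, p) u \<longrightarrow> (c u w \<longleftrightarrow> c (x, p) w)"
    unfolding L_def by (rule Lb.AE_pair)
  \<comment> \<open>A single position \<open>x\<close> is enough, since \<open>c\<close> is invariant under translations.\<close>
  then obtain x where x: "AE p in Q. AE u in L. AE w in L. c (x, p) u \<longrightarrow> (c u w \<longleftrightarrow> c (x, p) w)"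
    using AE_lborel_ex by blast
  have [measurable]: "(\<lambda>y. (y, r)) \<in> borel \<rightarrow>\<^sub>M L" if "r \<in> space Q" for r
    using that unfolding L_def by measurable
  have triple: "AE r in Q. AE q in Q. AE y in lborel. AE v in lborel.
      c (x, p) (y, r) \<longrightarrow> (c (y, r) (v, q) \<longleftrightarrow> c (x, p) (v, q))"
    if p [measurable]: "p \<in> space Q" and P: "AE u in L. AE w in L. c (x, p) u \<longrightarrow> (c u w \<longleftrightarrow> c (x, p) w)" for p
  proof -
    have xp [measurable]: "(x, p) \<in> space L" using p by (simp add: L_def space_pair_measure)
    have "AE r in Q. AE y in lborel. AE w in L. c (x, p) (y, r) \<longrightarrow> (c (y, r) w \<longleftrightarrow> c (x, p) w)"
      using Lb.AE_pair_swapped[OF P[unfolded L_def]] unfolding L_def .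
    with AE_space show ?thesis
    proof eventually_elim
      case (elim r)
      note [measurable] = elim(1)
      have "AE y in lborel. AE q in Q. AE v in lborel.
          c (x, p) (y, r) \<longrightarrow> (c (y, r) (v, q) \<longleftrightarrow> c (x, p) (v, q))"
        using elim(2) unfolding L_def by eventually_elim (rule Lb.AE_pair_swapped)
      moreover have "Measurable.pred (lborel \<Otimes>\<^sub>M Q) (\<lambda>s. AE v in lborel.
          c (x, p) (fst s, r) \<longrightarrow> (c (fst s, r) (v, snd s) \<longleftrightarrow> c (x, p) (v, snd s)))"
      proof (rule lborel.pred_AE)
        have [measurable]: "(\<lambda>s. (snd s, snd (fst s))) \<in> (lborel \<Otimes>\<^sub>M Q) \<Otimes>\<^sub>M lborel \<rightarrow>\<^sub>M L"
          "(\<lambda>s. (fst (fst s), r)) \<in> (lborel \<Otimes>\<^sub>M Q) \<Otimes>\<^sub>M lborel \<rightarrow>\<^sub>M L"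
          unfolding L_def by measurable
        show "Measurable.pred ((lborel \<Otimes>\<^sub>M Q) \<Otimes>\<^sub>M lborel) (\<lambda>(s, v).
            c (x, p) (fst s, r) \<longrightarrow> (c (fst s, r) (v, snd s) \<longleftrightarrow> c (x, p) (v, snd s)))"
          unfolding split_beta' by measurable
      qed
      ultimately show ?case
        by (intro Lb.AE_commute[THEN iffD1]) (simp_all add: pred_def)
    qed
  qed
  have nonnull': "AE p in Q. AE q in Q. \<not> (AE x in lborel. \<not> c (0, p) (x, q))"
    using QQ.AE_pair[OF nonnull] by simp
  have "c (x, p) (v, q) \<longleftrightarrow> c (x', p) (v + (x' - x), q)" for x x' p v q
    by (subst (1 2) shift) (simp add: algebra_simps)
  then have move: "(AE v in lborel. R (c (x, p) (v, q)))" if "AE v in lborel. R (c (x', p) (v, q))"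
    for x x' p q and R :: "bool \<Rightarrow> bool"
    using AE_lborel_shift[OF that, of "x' - x"] by simp
  have "AE p in Q. AE q in Q. \<forall>x'. AE v in lborel. c (x', p) (v, q)"
    using x nonnull' AE_space
  proof eventually_elim
    case (elim p)
    have [measurable]: "(x, p) \<in> space L" using elim(3) by (simp add: L_def space_pair_measure)
    have meas_slice: "{y. c (x, p) (y, q)} \<in> sets borel" if [measurable]: "q \<in> space Q" for q
    proof -
      have "Measurable.pred borel (\<lambda>y. c (x, p) (y, q))" by measurable
      then show ?thesis by (simp add: pred_def)
    qed
    \<comment> \<open>The intermediate mark \<open>r\<close> serves only to shift the slice and disappears from the conclusion.\<close>
    have "AE r in Q. AE q in Q. \<forall>x'. AE v in lborel. c (x', p) (v, q)"
      using triple[OF elim(3,1)] elim(2) AE_space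
    proof eventually_elim
      case (elim r)
      note r = elim
      show ?case
        using r(1) \<open>AE q in Q. \<not> (AE x in lborel. \<not> c (0, p) (x, q))\<close> AE_space
      proof eventually_elim
        case (elim q)
        have "AE v in lborel. v \<in> {v. c (x, p) (v, q)}"
        proof (rule shift_dichotomy)
          show "{v. c (x, p) (v, q)} \<in> sets borel" "{v. c (x, p) (v, r)} \<in> sets borel"
            using elim(3) r(3) by (auto intro!: meas_slice)
          show "\<not> (AE v in lborel. v \<notin> {v. c (x, p) (v, q)})" "\<not> (AE v in lborel. v \<notin> {v. c (x, p) (v, r)})"
            using move[of Not x p _ 0] elim(2) r(2) by auto
          have "v - y \<in> {v. c (0, r) (v, q)} \<longleftrightarrow> c (y, r) (v, q)" for v y
            by (subst (2) shift) simp
          then show "AE y in lborel. y \<in> {v. c (x, p) (v, r)} \<longrightarrow>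
              (AE v in lborel. v - y \<in> {v. c (0, r) (v, q)} \<longleftrightarrow> v \<in> {v. c (x, p) (v, q)})"
            using elim(1) by (auto elim!: eventually_mono)
        qed
        then show ?case using move[of "\<lambda>b. b" x p q] by auto
      qed
    qed
    then show ?case by simp
  qed
  then have ae: "AE p in Q. AE x in lborel. AE w in L. c (x, p) w"
    using AE_space
  proof eventually_elim
    case (elim p)
    show ?case
    proof (rule AE_I2)
      fix x :: 'a
      have [measurable]: "(x, p) \<in> space L" using elim(2) by (simp add: L_def space_pair_measure)
      show "AE w in L. c (x, p) w"
        unfolding L_def
      proof (rule Lb.AE_pair_measure_swapped)
        show "Measurable.pred (lborel \<Otimes>\<^sub>M Q) (c (x, p))"
          unfolding L_def[symmetric] by measurable
        show "AE q in Q. AE v in lborel. c (x, p) (v, q)"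
          using elim(1) by eventually_elim simp
      qed
    qed
  qed
  have "AE z in L. AE w in L. c z w"
    unfolding L_def
  proof (rule Lb.AE_pair_measure_swapped)
    show "Measurable.pred (lborel \<Otimes>\<^sub>M Q) (\<lambda>z. AE w in lborel \<Otimes>\<^sub>M Q. c z w)"
      unfolding L_def[symmetric] by measurable
  qed (rule ae[unfolded L_def])
  then have "AE s in L \<Otimes>\<^sub>M L. case s of (z, w) \<Rightarrow> c z w"
    using meas' by (intro LL.AE_pair_measure) (auto simp: pred_def)
  then show ?thesis unfolding L_def .
qed

section \<open>Powers of the connection function\<close>

locale marked_connection =
  fixes Q :: "'m::polish_space measure"
    and \<phi> :: "(real ^ 'd) \<times> 'm \<Rightarrow> (real ^ 'd) \<times> 'm \<Rightarrow> real"
  assumes prob_Q: "prob_space Q" and sets_Q [measurable_cong]: "sets Q = sets borel"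
    and conn: "connection_function Q \<phi>"
begin

sublocale Q: prob_space Q by (rule prob_Q)

definition L :: "((real ^ 'd) \<times> 'm) measure" where "L = marked_lebesgue Q"

sublocale LQ: pair_sigma_finite "lborel :: (real ^ 'd) measure" Q ..
sublocale L: sigma_finite_measure L
  unfolding L_def by (rule LQ.sigma_finite_measure_axioms)
sublocale LL: pair_sigma_finite L L ..

lemma sets_L [measurable_cong]: "sets L = sets borel"
proof -
  have "sets L = sets ((borel :: (real ^ 'd) measure) \<Otimes>\<^sub>M (borel :: 'm measure))"
    unfolding L_def by (intro sets_pair_measure_cong) (simp_all add: sets_Q)
  then show ?thesis unfolding borel_prod .
qed

lemma space_L [simp]: "space L = UNIV"
  using sets_eq_imp_space_eq[OF sets_L] by simp

lemma space_Q [simp]: "space Q = UNIV"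
  using sets_eq_imp_space_eq[OF sets_Q] by simp

lemma conn_nonneg: "0 \<le> \<phi> z w" and conn_le_1: "\<phi> z w \<le> 1" and conn_sym: "\<phi> z w = \<phi> w z"
  and conn_shift: "\<phi> (x, p) (y, q) = \<phi> (0, p) (y - x, q)"
  using conn unfolding connection_function_def by blast+

lemma measurable_conn [measurable]:
  assumes "f \<in> M \<rightarrow>\<^sub>M borel" "g \<in> M \<rightarrow>\<^sub>M borel"
  shows "(\<lambda>s. \<phi> (f s) (g s)) \<in> borel_measurable M"
proof -
  have "(\<lambda>(z, w). \<phi> z w) \<in> borel_measurable (borel \<Otimes>\<^sub>M borel)"
    using conn unfolding connection_function_def by (simp add: borel_prod)
  from measurable_compose[OF measurable_Pair[OF assms] this] show ?thesis by simp
qed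

abbreviation "cpow \<equiv> conn_pow Q \<phi>"

lemma cpow_Suc_Suc: "cpow (Suc (Suc n)) z w = (\<integral>\<^sup>+u. cpow (Suc n) z u * ennreal (\<phi> u w) \<partial>L)"
  by (simp add: L_def)

lemma measurable_cpow':
  "(\<lambda>s. cpow n (fst s) (snd s)) \<in> borel_measurable (borel \<Otimes>\<^sub>M borel)"
proof (induction n rule: induct_nat_012)
  case (ge2 n)
  note [measurable] = ge2(2)
  have [measurable]: "(\<lambda>x. cpow (Suc n) (fst (fst x)) (snd x)) \<in> borel_measurable ((borel \<Otimes>\<^sub>M borel) \<Otimes>\<^sub>M L)"
    using measurable_compose[OF _ ge2(2), of "\<lambda>x. (fst (fst x), snd x)" "(borel \<Otimes>\<^sub>M borel) \<Otimes>\<^sub>M L"]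
    by simp
  show ?case
    unfolding cpow_Suc_Suc by measurable
qed auto

lemma measurable_cpow [measurable]:
  assumes "f \<in> M \<rightarrow>\<^sub>M borel" "g \<in> M \<rightarrow>\<^sub>M borel"
  shows "(\<lambda>s. cpow n (f s) (g s)) \<in> borel_measurable M"
  using measurable_compose[OF measurable_Pair[OF assms] measurable_cpow'] by simp

lemma cpow_chapman_kolmogorov:
  "cpow (Suc a + Suc b) z w = (\<integral>\<^sup>+u. cpow (Suc a) z u * cpow (Suc b) u w \<partial>L)"
proof (induction b arbitrary: w)
  case 0
  show ?case by (simp add: L_def)
next
  case (Suc b)
  have "cpow (Suc a + Suc (Suc b)) z w = (\<integral>\<^sup>+v. cpow (Suc a + Suc b) z v * ennreal (\<phi> v w) \<partial>L)"
    using cpow_Suc_Suc[of "a + Suc b"] by simp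
  also have "\<dots> = (\<integral>\<^sup>+v. \<integral>\<^sup>+u. cpow (Suc a) z u * (cpow (Suc b) u v * ennreal (\<phi> v w)) \<partial>L \<partial>L)"
    unfolding Suc by (simp add: nn_integral_multc[symmetric] mult.assoc)
  also have "\<dots> = (\<integral>\<^sup>+u. \<integral>\<^sup>+v. cpow (Suc a) z u * (cpow (Suc b) u v * ennreal (\<phi> v w)) \<partial>L \<partial>L)"
    by (rule LL.Fubini') measurable
  also have "\<dots> = (\<integral>\<^sup>+u. cpow (Suc a) z u * cpow (Suc (Suc b)) u w \<partial>L)"
    by (simp only: cpow_Suc_Suc) (simp add: nn_integral_cmult)
  finally show ?case .
qed

text \<open>
  Splitting off the first step of a path from \<open>w\<close> instead of the last step of a path from \<open>z\<close> needs
  the Chapman-Kolmogorov equation.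
\<close>

lemma cpow_sym: "cpow n z w = cpow n w z"
proof (induction n arbitrary: z w rule: induct_nat_012)
  case (ge2 n)
  have "cpow (Suc (Suc n)) z w = (\<integral>\<^sup>+u. cpow (Suc n) z u * ennreal (\<phi> u w) \<partial>L)"
    by (rule cpow_Suc_Suc)
  also have "\<dots> = (\<integral>\<^sup>+u. cpow (Suc 0) w u * cpow (Suc n) u z \<partial>L)"
    by (intro nn_integral_cong) (simp add: ge2(2)[of z] conn_sym[of w] mult.commute)
  also have "\<dots> = cpow (Suc (Suc n)) w z"
    using cpow_chapman_kolmogorov[of 0 n w z] by simp
  finally show ?case .
qed (auto simp: conn_sym)

lemma nn_integral_L_shift:
  assumes [measurable]: "f \<in> borel_measurable L"
  shows "(\<integral>\<^sup>+u. f u \<partial>L) = (\<integral>\<^sup>+(y, q). f (y + x, q) \<partial>L)"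
proof -
  have [measurable]: "f \<in> borel_measurable (lborel \<Otimes>\<^sub>M Q)"
    using assms by (simp add: L_def)
  have "(\<integral>\<^sup>+u. f u \<partial>L) = (\<integral>\<^sup>+q. \<integral>\<^sup>+y. f (y, q) \<partial>lborel \<partial>Q)"
    unfolding L_def by (subst LQ.nn_integral_snd) auto
  also have "\<dots> = (\<integral>\<^sup>+q. \<integral>\<^sup>+y. f (y, q) \<partial>distr lborel borel ((+) x) \<partial>Q)"
    by (simp add: lborel_distr_plus)
  also have "\<dots> = (\<integral>\<^sup>+q. \<integral>\<^sup>+y. f (y + x, q) \<partial>lborel \<partial>Q)"
    by (intro nn_integral_cong, subst nn_integral_distr) (simp_all add: add.commute)
  also have "\<dots> = (\<integral>\<^sup>+(y, q). f (y + x, q) \<partial>L)"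
    unfolding L_def by (subst LQ.nn_integral_snd[symmetric]) (auto simp: split_beta')
  finally show ?thesis .
qed

lemma cpow_shift: "cpow n (x, p) (y, q) = cpow n (0, p) (y - x, q)"
proof (induction n arbitrary: y q rule: induct_nat_012)
  case 1
  show ?case by (simp add: conn_shift[of x])
next
  case (ge2 n)
  have "cpow (Suc (Suc n)) (x, p) (y, q)
      = (\<integral>\<^sup>+(v, r). cpow (Suc n) (x, p) (v + x, r) * ennreal (\<phi> (v + x, r) (y, q)) \<partial>L)"
    unfolding cpow_Suc_Suc by (subst nn_integral_L_shift[of _ x]) auto
  also have "\<dots> = (\<integral>\<^sup>+u. cpow (Suc n) (0, p) u * ennreal (\<phi> u (y - x, q)) \<partial>L)"
  proof (intro nn_integral_cong, clarify)
    fix v r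
    have "\<phi> (v + x, r) (y, q) = \<phi> (v, r) (y - x, q)"
      by (subst (1 2) conn_shift) (simp add: algebra_simps)
    then show "cpow (Suc n) (x, p) (v + x, r) * ennreal (\<phi> (v + x, r) (y, q))
        = cpow (Suc n) (0, p) (v, r) * ennreal (\<phi> (v, r) (y - x, q))"
      using ge2(2)[of "v + x" r] by simp
  qed
  also have "\<dots> = cpow (Suc (Suc n)) (0, p) (y - x, q)"
    by (rule cpow_Suc_Suc[symmetric])
  finally show ?case .
qed auto

text \<open>
  The index is shifted because the connection powers start at 1.
\<close>

definition linked :: "(real ^ 'd) \<times> 'm \<Rightarrow> (real ^ 'd) \<times> 'm \<Rightarrow> bool" where
  "linked z w \<longleftrightarrow> (\<exists>n. cpow (Suc n) z w > 0)"

lemma measurable_linked [measurable (raw)]: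
  assumes [measurable]: "f \<in> M \<rightarrow>\<^sub>M borel" "g \<in> M \<rightarrow>\<^sub>M borel"
  shows "Measurable.pred M (\<lambda>s. linked (f s) (g s))"
  unfolding linked_def by measurable

lemma linked_sym: "linked z w \<longleftrightarrow> linked w z"
  unfolding linked_def by (metis cpow_sym)

lemma linked_shift: "linked (x, p) (y, q) \<longleftrightarrow> linked (0, p) (y - x, q)"
  unfolding linked_def using cpow_shift by metis

text \<open>
  If \<open>z\<close> and \<open>w\<close> are not linked, all the integrals in the Chapman-Kolmogorov equation vanish. A single
  intermediate point proves nothing, since it may belong to a null set.
\<close>

lemma linked_trans_AE: "AE u in L. linked z u \<and> linked u w \<longrightarrow> linked z w"
proof (cases "linked z w")
  case False
  have "AE u in L. cpow (Suc a) z u * cpow (Suc b) u w = 0" for a b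
  proof -
    have "(\<integral>\<^sup>+u. cpow (Suc a) z u * cpow (Suc b) u w \<partial>L) = 0"
      using False cpow_chapman_kolmogorov[of a b z w]
      by (auto simp: linked_def simp del: conn_pow.simps)
    then show ?thesis by (subst (asm) nn_integral_0_iff_AE) auto
  qed
  then have "AE u in L. \<forall>a b. cpow (Suc a) z u * cpow (Suc b) u w = 0"
    unfolding AE_all_countable by blast
  then show ?thesis
    by eventually_elim (auto simp: linked_def simp del: conn_pow.simps)
qed auto

lemma d_conn_pos_iff:
  "(SUP n\<in>{1..}. d_conn Q \<phi> n p q) > 0 \<longleftrightarrow> \<not> (AE x in lborel. \<not> linked (0, p) (x, q))"
proof -
  have "d_conn Q \<phi> n p q = 0 \<longleftrightarrow> (AE x in lborel. cpow n (0, p) (x, q) = 0)" for n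
    unfolding d_conn_def by (subst nn_integral_0_iff_AE) auto
  note zero = this
  have "(SUP n\<in>{1..}. d_conn Q \<phi> n p q) > 0 \<longleftrightarrow> (\<exists>n\<in>{1..}. d_conn Q \<phi> n p q > 0)"
    by (rule less_SUP_iff)
  also have "\<dots> \<longleftrightarrow> (\<exists>n. d_conn Q \<phi> (Suc n) p q > 0)"
    by (metis One_nat_def Suc_le_D atLeast_iff le_add1 plus_1_eq_Suc)
  also have "\<dots> \<longleftrightarrow> \<not> (\<forall>n. AE x in lborel. cpow (Suc n) (0, p) (x, q) = 0)"
    unfolding zero_less_iff_neq_zero zero by blast
  also have "\<dots> \<longleftrightarrow> \<not> (AE x in lborel. \<not> linked (0, p) (x, q))"
    unfolding AE_all_countable[symmetric] linked_def zero_less_iff_neq_zero by simp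
  finally show ?thesis .
qed

lemma measurable_linked_pair: "Measurable.pred (L \<Otimes>\<^sub>M L) (\<lambda>(z, w). linked z w)"
  unfolding split_beta' by measurable

text \<open>
  The direction from slices to pairs is the one where positive measure is improved to full measure; the
  other one is Fubini's theorem and stationarity.
\<close>

lemma AE_linked_iff:
  "(AE (z, w) in L \<Otimes>\<^sub>M L. linked z w) \<longleftrightarrow>
   (AE (p, q) in Q \<Otimes>\<^sub>M Q. \<not> (AE x in lborel. \<not> linked (0, p) (x, q)))"
proof
  assume "AE (p, q) in Q \<Otimes>\<^sub>M Q. \<not> (AE x in lborel. \<not> linked (0, p) (x, q))"
  then show "AE (z, w) in L \<Otimes>\<^sub>M L. linked z w"
    unfolding L_def
    by (rule invariant_relation_full[OF prob_Q measurable_linked_pair[unfolded L_def]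
          linked_sym linked_shift linked_trans_AE[unfolded L_def]])
next
  assume "AE (z, w) in L \<Otimes>\<^sub>M L. linked z w"
  then have "AE z in L. AE w in L. linked z w"
    using LL.AE_pair by force
  then have "AE x in lborel. AE p in Q. AE w in L. linked (x, p) w"
    unfolding L_def by (rule LQ.AE_pair)
  then obtain x where x: "AE p in Q. AE w in L. linked (x, p) w"
    using AE_lborel_ex by blast
  interpret QQ: pair_sigma_finite Q Q ..
  show "AE (p, q) in Q \<Otimes>\<^sub>M Q. \<not> (AE x in lborel. \<not> linked (0, p) (x, q))"
  proof (rule QQ.AE_pair_measure)
    have "Measurable.pred (Q \<Otimes>\<^sub>M Q) (\<lambda>s. AE x in lborel. \<not> linked (0, fst s) (x, snd s))"
      by (rule lborel.pred_AE) (unfold split_beta', measurable)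
    then have "Measurable.pred (Q \<Otimes>\<^sub>M Q) (\<lambda>s. \<not> (AE x in lborel. \<not> linked (0, fst s) (x, snd s)))"
      by (rule pred_intros_logic)
    then show "{s \<in> space (Q \<Otimes>\<^sub>M Q). case s of (p, q) \<Rightarrow> \<not> (AE x in lborel. \<not> linked (0, p) (x, q))} \<in> sets (Q \<Otimes>\<^sub>M Q)"
      by (simp add: pred_def split_beta')
    show "AE p in Q. AE q in Q. case (p, q) of (p, q) \<Rightarrow> \<not> (AE x in lborel. \<not> linked (0, p) (x, q))"
      using x
    proof eventually_elim
      case (elim p)
      then have "AE q in Q. AE y in lborel. linked (x, p) (y, q)"
        unfolding L_def by (rule LQ.AE_pair_swapped)
      then show ?case
      proof eventually_elim
        case (elim q)
        have "AE y in lborel. linked (x, p) (y + x, q)"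
          using elim by (rule AE_lborel_shift)
        then have pos: "AE y in lborel. linked (0, p) (y, q)"
          by (subst (asm) linked_shift) simp
        have "\<not> (AE y in lborel. \<not> linked (0, p) (y, q))"
        proof
          assume "AE y in lborel. \<not> linked (0, p) (y, q)"
          with pos have "AE y in lborel. linked (0, p) (y, q) \<and> \<not> linked (0, p) (y, q)"
            by (rule eventually_conj)
          then show False using AE_lborel_ex by blast
        qed
        then show ?case by simp
      qed
    qed
  qed
qed

end

section \<open>Tuples of distinct points of a Poisson process\<close>

text \<open>
  The results of this section hold for a Poisson process with sigma-finite intensity on a separable
  metric space. The intensity may have atoms, so that several indices may stand for the same
  point; this is why only tuples of distinct points are considered.
\<close>

locale enumerated_poisson_process = prob_space P + \<mu>: sigma_finite_measure \<mu>
  for P :: "'w measure" and \<mu> :: "'a::{second_countable_topology, metric_space} measure" and X :: "nat \<Rightarrow> 'w \<Rightarrow> 'a" +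
  assumes sets_\<mu> [measurable_cong]: "sets \<mu> = sets borel"
    and measurable_X [measurable]: "\<And>i. X i \<in> P \<rightarrow>\<^sub>M borel"
    and poisson: "poisson_process P \<mu> (dirac_sum X)"
begin

lemma space_\<mu> [simp]: "space \<mu> = UNIV"
  using sets_eq_imp_space_eq[OF sets_\<mu>] by simp

lemma emeasure_dirac_sum:
  assumes "A \<in> sets borel"
  shows "emeasure (dirac_sum X \<omega>) A = (\<integral>\<^sup>+i. indicator A (X i \<omega>) \<partial>count_space UNIV)"
proof -
  have "emeasure (dirac_sum X \<omega>) A = emeasure (count_space UNIV) {i. X i \<omega> \<in> A}"
    unfolding dirac_sum_def using assms by (subst emeasure_distr) (auto simp: vimage_def)
  also have "\<dots> = (\<integral>\<^sup>+i. indicator {i. X i \<omega> \<in> A} i \<partial>count_space UNIV)"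
    by (rule nn_integral_indicator[symmetric]) simp
  finally show ?thesis by (simp add: indicator_def)
qed

text \<open>
  The Poisson weights sum to one, so the count is almost surely finite and its mean is their mean.
\<close>

lemma expected_count:
  assumes A: "A \<in> sets borel" and fin: "emeasure \<mu> A < \<infinity>"
  shows "(\<integral>\<^sup>+\<omega>. emeasure (dirac_sum X \<omega>) A \<partial>P) = emeasure \<mu> A"
proof -
  define \<eta> where "\<eta> \<omega> = emeasure (dirac_sum X \<omega>) A" for \<omega>
  define m where "m = measure \<mu> A"
  have A\<mu>: "A \<in> sets \<mu>" using A by (simp add: sets_\<mu>)
  have [measurable]: "\<eta> \<in> borel_measurable P"
    using poisson A\<mu> unfolding poisson_process_def \<eta>_def by blast
  define E where "E k = {\<omega> \<in> space P. \<eta> \<omega> = of_nat k}" for k :: nat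
  have [measurable]: "E k \<in> sets P" for k unfolding E_def by measurable
  have prob_E: "prob (E k) = m ^ k / fact k * exp (- m)" for k
    using poisson A\<mu> fin unfolding poisson_process_def E_def \<eta>_def m_def by blast
  have exp_sums: "(\<lambda>k. m ^ k / fact k) sums exp m"
    using exp_converges[of m] by (simp add: divide_inverse mult.commute)
  have "disjoint_family E" by (auto simp: disjoint_family_on_def E_def)
  then have "(\<lambda>k. prob (E k)) sums prob (\<Union>k. E k)" by (intro finite_measure_UNION) auto
  moreover have "(\<lambda>k. prob (E k)) sums 1"
    using sums_mult2[OF exp_sums, of "exp (- m)"] by (simp add: prob_E exp_minus_inverse)
  ultimately have "prob (\<Union>k. E k) = 1" by (rule sums_unique2)
  then have ae: "AE \<omega> in P. \<omega> \<in> (\<Union>k. E k)" by (rule AE_prob_1)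
  have "(\<lambda>k. real (Suc k) * (m ^ Suc k / fact (Suc k))) sums (m * exp m)"
    using sums_mult[OF exp_sums, of m] by (simp add: field_simps del: of_nat_Suc)
  then have "(\<lambda>k. real k * (m ^ k / fact k)) sums (m * exp m)"
    using sums_Suc_iff[of "\<lambda>k. real k * (m ^ k / fact k)"] by simp
  from sums_mult2[OF this, of "exp (- m)"] have mean: "(\<lambda>k. real k * prob (E k)) sums m"
    by (simp add: prob_E mult.assoc exp_minus_inverse)
  have "(\<integral>\<^sup>+\<omega>. \<eta> \<omega> \<partial>P) = (\<integral>\<^sup>+\<omega>. (\<Sum>k. of_nat k * indicator (E k) \<omega>) \<partial>P)"
  proof (rule nn_integral_cong_AE, use ae in eventually_elim)
    case (elim \<omega>)
    then obtain k where k: "\<omega> \<in> E k" by auto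
    have "(\<Sum>j. of_nat j * indicator (E j) \<omega>) = (\<Sum>j\<in>{k}. of_nat j * indicator (E j) \<omega> :: ennreal)"
      using k by (intro suminf_finite) (auto simp: E_def indicator_def)
    also have "\<dots> = of_nat k" using k by simp
    also have "\<dots> = \<eta> \<omega>" using k by (simp add: E_def)
    finally show ?case by (rule sym)
  qed
  also have "\<dots> = (\<Sum>k. of_nat k * emeasure P (E k))"
    by (subst nn_integral_suminf) (auto simp: nn_integral_cmult)
  also have "\<dots> = (\<Sum>k. ennreal (real k * prob (E k)))"
    by (intro suminf_cong) (simp only: emeasure_eq_measure ennreal_of_nat_eq_real_of_nat ennreal_mult''[OF measure_nonneg])
  also have "\<dots> = ennreal m"
    using mean by (subst suminf_ennreal2) (auto simp: sums_iff)
  also have "\<dots> = emeasure \<mu> A"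
    unfolding m_def using fin by (intro emeasure_eq_ennreal_measure[symmetric]) auto
  finally show ?thesis by (simp add: \<eta>_def)
qed

text \<open>
  Disjointness of the sets makes the counts independent. Overlapping sets would contribute
  diagonal terms, where the same point is counted for two factors.
\<close>

lemma expected_product_count:
  fixes k :: nat
  assumes A: "\<And>l. l < k \<Longrightarrow> A l \<in> sets borel" "\<And>l. l < k \<Longrightarrow> emeasure \<mu> (A l) < \<infinity>"
    and disj: "disjoint_family_on A {..<k}"
  shows "(\<integral>\<^sup>+\<omega>. (\<Prod>l<k. emeasure (dirac_sum X \<omega>) (A l)) \<partial>P) = (\<Prod>l<k. emeasure \<mu> (A l))"
proof -
  have "indep_vars (\<lambda>_. borel) (\<lambda>l \<omega>. emeasure (dirac_sum X \<omega>) (A l)) {..<k}"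
    using poisson A(1) disj unfolding poisson_process_def by (simp add: sets_\<mu>)
  then have "(\<integral>\<^sup>+\<omega>. (\<Prod>l<k. emeasure (dirac_sum X \<omega>) (A l)) \<partial>P)
      = (\<Prod>l<k. \<integral>\<^sup>+\<omega>. emeasure (dirac_sum X \<omega>) (A l) \<partial>P)"
    by (intro indep_vars_nn_integral) auto
  also have "\<dots> = (\<Prod>l<k. emeasure \<mu> (A l))"
    using A by (intro prod.cong) (auto intro!: expected_count)
  finally show ?thesis .
qed

lemma product_sigma_finite_\<mu>: "product_sigma_finite (\<lambda>_::nat. \<mu>)"
  unfolding product_sigma_finite_def by (intro allI \<mu>.sigma_finite_measure_axioms)

definition tuple :: "nat \<Rightarrow> (nat \<Rightarrow> nat) \<Rightarrow> 'w \<Rightarrow> nat \<Rightarrow> 'a" where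
  "tuple k i \<omega> = (\<lambda>l\<in>{..<k}. X (i l) \<omega>)"

abbreviation "indices (k::nat) \<equiv> PiE {..<k} (\<lambda>_. UNIV :: nat set)"

lemma measurable_tuple [measurable]: "tuple k i \<in> P \<rightarrow>\<^sub>M PiM {..<k} (\<lambda>_. \<mu>)"
proof -
  have "X (i l) \<in> P \<rightarrow>\<^sub>M \<mu>" for l
    using measurable_X by (simp add: measurable_cong_sets[OF refl sets_\<mu>])
  then show ?thesis unfolding tuple_def by (intro measurable_restrict)
qed

text \<open>
  The moment measure of order \<open>k\<close> of the process. It counts index tuples with repetitions, so in general it agrees
  with the factorial moment measure only on tuples of distinct points.
\<close>

definition tuple_measure :: "nat \<Rightarrow> (nat \<Rightarrow> 'a) measure" where
  "tuple_measure k = distr (count_space (indices k) \<Otimes>\<^sub>M P) (PiM {..<k} (\<lambda>_. \<mu>)) (\<lambda>(i, \<omega>). tuple k i \<omega>)"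

lemma countable_indices: "countable (indices k)"
  by (intro countable_PiE) auto

lemma measurable_tuple_pair [measurable]:
  "(\<lambda>(i, \<omega>). tuple k i \<omega>) \<in> count_space (indices k) \<Otimes>\<^sub>M P \<rightarrow>\<^sub>M PiM {..<k} (\<lambda>_. \<mu>)"
  by (rule measurable_pair_measure_countable1[OF countable_indices]) (simp add: measurable_tuple)

lemma sets_tuple_measure [simp, measurable_cong]: "sets (tuple_measure k) = sets (PiM {..<k} (\<lambda>_. \<mu>))"
  by (simp add: tuple_measure_def)

lemma space_tuple_measure [simp]: "space (tuple_measure k) = space (PiM {..<k} (\<lambda>_. \<mu>))"
  by (simp add: tuple_measure_def)

lemma nn_integral_tuple_measure:
  assumes [measurable]: "f \<in> borel_measurable (PiM {..<k} (\<lambda>_. \<mu>))"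
  shows "(\<integral>\<^sup>+x. f x \<partial>tuple_measure k) = (\<integral>\<^sup>+i. \<integral>\<^sup>+\<omega>. f (tuple k i \<omega>) \<partial>P \<partial>count_space (indices k))"
    and "(\<integral>\<^sup>+x. f x \<partial>tuple_measure k) = (\<integral>\<^sup>+\<omega>. \<integral>\<^sup>+i. f (tuple k i \<omega>) \<partial>count_space (indices k) \<partial>P)"
proof -
  interpret C: sigma_finite_measure "count_space (indices k)"
    by (rule sigma_finite_measure_count_space_countable[OF countable_indices])
  interpret CP: pair_sigma_finite "count_space (indices k)" P ..
  have "(\<integral>\<^sup>+x. f x \<partial>tuple_measure k) = (\<integral>\<^sup>+s. f (tuple k (fst s) (snd s)) \<partial>(count_space (indices k) \<Otimes>\<^sub>M P))"
    unfolding tuple_measure_def by (subst nn_integral_distr) (auto simp: split_beta')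
  moreover have [measurable]: "(\<lambda>s. f (tuple k (fst s) (snd s))) \<in> borel_measurable (count_space (indices k) \<Otimes>\<^sub>M P)"
    using measurable_compose[OF measurable_tuple_pair assms] by (simp add: split_beta')
  moreover note nn_integral_fst[OF this] CP.nn_integral_snd[OF this]
  ultimately show "(\<integral>\<^sup>+x. f x \<partial>tuple_measure k) = (\<integral>\<^sup>+i. \<integral>\<^sup>+\<omega>. f (tuple k i \<omega>) \<partial>P \<partial>count_space (indices k))"
    "(\<integral>\<^sup>+x. f x \<partial>tuple_measure k) = (\<integral>\<^sup>+\<omega>. \<integral>\<^sup>+i. f (tuple k i \<omega>) \<partial>count_space (indices k) \<partial>P)"
    by (simp_all add: split_beta')
qed

lemma tuple_measure_null_iff:
  assumes [measurable]: "B \<in> sets (PiM {..<k} (\<lambda>_. \<mu>))"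
  shows "emeasure (tuple_measure k) B = 0 \<longleftrightarrow> (\<forall>i\<in>indices k. AE \<omega> in P. tuple k i \<omega> \<notin> B)"
proof -
  have "emeasure (tuple_measure k) B
      = (\<integral>\<^sup>+i. \<integral>\<^sup>+\<omega>. indicator B (tuple k i \<omega>) \<partial>P \<partial>count_space (indices k))"
    by (simp add: nn_integral_tuple_measure(1)[symmetric])
  also have "\<dots> = 0 \<longleftrightarrow> (\<forall>i\<in>indices k. (\<integral>\<^sup>+\<omega>. indicator B (tuple k i \<omega>) \<partial>P) = (0::ennreal))"
    by (subst nn_integral_0_iff_AE) (auto simp: AE_count_space)
  also have "\<dots> \<longleftrightarrow> (\<forall>i\<in>indices k. AE \<omega> in P. tuple k i \<omega> \<notin> B)"
    by (subst nn_integral_0_iff_AE) (auto simp: indicator_eq_0_iff)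
  finally show ?thesis .
qed

text \<open>
  Summed over all index tuples, the product of the indicators factorizes into the product of the
  counts.
\<close>

lemma tuple_measure_PiE:
  assumes A: "\<And>l. l < k \<Longrightarrow> A l \<in> sets borel"
  shows "emeasure (tuple_measure k) (PiE {..<k} A) = (\<integral>\<^sup>+\<omega>. (\<Prod>l<k. emeasure (dirac_sum X \<omega>) (A l)) \<partial>P)"
proof -
  interpret C: product_sigma_finite "\<lambda>_::nat. count_space (UNIV :: nat set)"
    unfolding product_sigma_finite_def by (intro allI sigma_finite_measure_count_space_countable) simp
  have [measurable]: "PiE {..<k} A \<in> sets (PiM {..<k} (\<lambda>_. \<mu>))"
    using A by (intro sets_PiM_I_finite) (auto simp: sets_\<mu>)
  have "emeasure (tuple_measure k) (PiE {..<k} A)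
      = (\<integral>\<^sup>+\<omega>. \<integral>\<^sup>+i. indicator (PiE {..<k} A) (tuple k i \<omega>) \<partial>count_space (indices k) \<partial>P)"
    by (simp add: nn_integral_tuple_measure(2)[symmetric])
  also have "\<dots> = (\<integral>\<^sup>+\<omega>. (\<Prod>l<k. emeasure (dirac_sum X \<omega>) (A l)) \<partial>P)"
  proof (rule nn_integral_cong)
    fix \<omega>
    have "indicator (PiE {..<k} A) (tuple k i \<omega>) = (\<Prod>l<k. indicator (A l) (X (i l) \<omega>) :: ennreal)" for i
      by (auto simp: tuple_def indicator_def PiE_iff)
    then have "(\<integral>\<^sup>+i. indicator (PiE {..<k} A) (tuple k i \<omega>) \<partial>count_space (indices k))
        = (\<integral>\<^sup>+i. (\<Prod>l<k. indicator (A l) (X (i l) \<omega>)) \<partial>PiM {..<k} (\<lambda>_. count_space UNIV))"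
      by (simp add: count_space_PiM_finite)
    also have "\<dots> = (\<Prod>l<k. \<integral>\<^sup>+j. indicator (A l) (X j \<omega>) \<partial>count_space UNIV)"
      by (rule C.product_nn_integral_prod) auto
    also have "\<dots> = (\<Prod>l<k. emeasure (dirac_sum X \<omega>) (A l))"
      using A by (intro prod.cong) (auto simp: emeasure_dirac_sum)
    finally show "(\<integral>\<^sup>+i. indicator (PiE {..<k} A) (tuple k i \<omega>) \<partial>count_space (indices k))
        = (\<Prod>l<k. emeasure (dirac_sum X \<omega>) (A l))" .
  qed
  finally show ?thesis .
qed

text \<open>
  Rectangles inside the box have the same measure by independence of the counts, and both
  measures are finite on the box, so they agree on all measurable subsets.
\<close>

lemma tuple_measure_eq_on_disjoint_box:
  assumes U: "\<And>l. l < k \<Longrightarrow> U l \<in> sets borel" "\<And>l. l < k \<Longrightarrow> emeasure \<mu> (U l) < \<infinity>"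
    and disj: "disjoint_family_on U {..<k}"
    and B: "B \<in> sets (PiM {..<k} (\<lambda>_. \<mu>))" "B \<subseteq> PiE {..<k} U"
  shows "emeasure (tuple_measure k) B = emeasure (PiM {..<k} (\<lambda>_. \<mu>)) B"
proof -
  interpret product_\<mu>: product_sigma_finite "\<lambda>_::nat. \<mu>" by (rule product_sigma_finite_\<mu>)
  let ?U = "PiE {..<k} U" and ?M = "PiM {..<k} (\<lambda>_. \<mu>)"
  have Us [measurable]: "?U \<in> sets ?M"
    using U by (intro sets_PiM_I_finite) (auto simp: sets_\<mu>)
  have dens: "emeasure (density N (indicator ?U)) C = emeasure N (?U \<inter> C)"
    if "sets N = sets ?M" "C \<in> sets ?M" for N C
    using that Us by (subst emeasure_density) (auto simp: indicator_inter_arith[symmetric])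
  have box: "?U \<inter> PiE {..<k} A = PiE {..<k} (\<lambda>l. U l \<inter> A l)" for A
    by (auto simp: PiE_iff)
  have "density (tuple_measure k) (indicator ?U) = density ?M (indicator ?U)"
  proof (rule measure_eqI_PiM_finite[where I="{..<k}" and M="\<lambda>_. \<mu>" and A="\<lambda>_. space ?M"])
    fix A assume A: "\<And>l. l \<in> {..<k} \<Longrightarrow> A l \<in> sets \<mu>"
    have As: "PiE {..<k} A \<in> sets ?M" using A by (intro sets_PiM_I_finite) auto
    have fin: "emeasure \<mu> (U l \<inter> A l) < \<infinity>" if "l < k" for l
      using U[OF that] A that by (intro le_less_trans[OF emeasure_mono[of "U l \<inter> A l" "U l" \<mu>]]) (auto simp: sets_\<mu>)
    have "emeasure (density (tuple_measure k) (indicator ?U)) (PiE {..<k} A)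
        = emeasure (tuple_measure k) (PiE {..<k} (\<lambda>l. U l \<inter> A l))"
      using As by (simp add: dens box)
    also have "\<dots> = (\<integral>\<^sup>+\<omega>. (\<Prod>l<k. emeasure (dirac_sum X \<omega>) (U l \<inter> A l)) \<partial>P)"
      using U A by (intro tuple_measure_PiE) (auto simp: sets_\<mu>)
    also have "\<dots> = (\<Prod>l<k. emeasure \<mu> (U l \<inter> A l))"
    proof (rule expected_product_count)
      show "disjoint_family_on (\<lambda>l. U l \<inter> A l) {..<k}"
        using disj unfolding disjoint_family_on_def by blast
    qed (use U A fin in \<open>auto simp: sets_\<mu>\<close>)
    also have "\<dots> = emeasure ?M (PiE {..<k} (\<lambda>l. U l \<inter> A l))"
      using U A by (intro product_\<mu>.emeasure_PiM[symmetric]) (auto simp: sets_\<mu>)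
    also have "\<dots> = emeasure (density ?M (indicator ?U)) (PiE {..<k} A)"
      using As by (simp add: dens box)
    finally show "emeasure (density (tuple_measure k) (indicator ?U)) (PiE {..<k} A)
        = emeasure (density ?M (indicator ?U)) (PiE {..<k} A)" .
  next
    have "emeasure (density (tuple_measure k) (indicator ?U)) (space ?M) = emeasure (tuple_measure k) ?U"
      using sets.sets_into_space[OF Us] by (simp add: dens Int_absorb2)
    also have "\<dots> = (\<Prod>l<k. emeasure \<mu> (U l))"
      using U disj by (simp add: tuple_measure_PiE expected_product_count)
    also have "\<dots> \<noteq> \<infinity>"
      using U(2) by (simp add: ennreal_prod_eq_top less_top)
    finally show "emeasure (density (tuple_measure k) (indicator ?U)) (space ?M) \<noteq> \<infinity>" .
    show "range (\<lambda>_. space ?M) \<subseteq> prod_algebra {..<k} (\<lambda>_. \<mu>)"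
      using prod_algebraI_finite[of "{..<k}" "\<lambda>_. UNIV" "\<lambda>_. \<mu>"] by (auto simp: space_PiM)
  qed auto
  then have "emeasure (density (tuple_measure k) (indicator ?U)) B = emeasure (density ?M (indicator ?U)) B"
    by simp
  then show ?thesis using B by (simp add: dens Int_absorb1)
qed

end

lemma disjoint_balls_of_inj:
  fixes x :: "nat \<Rightarrow> 'a::metric_space"
  assumes "finite I" "inj_on x I"
  shows "\<exists>e>0. \<forall>l\<in>I. \<forall>m\<in>I. l \<noteq> m \<longrightarrow> ball (x l) e \<inter> ball (x m) e = {}"
proof -
  define S where "S = insert 1 {dist (x l) (x m) | l m. l \<in> I \<and> m \<in> I \<and> l \<noteq> m}"
  have "{dist (x l) (x m) | l m. l \<in> I \<and> m \<in> I \<and> l \<noteq> m} \<subseteq> (\<lambda>(l, m). dist (x l) (x m)) ` (I \<times> I)"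
    by auto
  then have "finite S"
    unfolding S_def using assms(1) by (simp add: finite_subset)
  moreover have "\<forall>s\<in>S. s > 0" using assms(2) by (auto simp: S_def inj_on_def)
  ultimately have M: "Min S > 0" by (subst Min_gr_iff) (auto simp: S_def)
  show ?thesis
  proof (intro exI[of _ "Min S / 2"] conjI ballI impI)
    fix l m assume "l \<in> I" "m \<in> I" "l \<noteq> m"
    then have le: "Min S \<le> dist (x l) (x m)"
      using \<open>finite S\<close> by (intro Min_le) (auto simp: S_def)
    show "ball (x l) (Min S / 2) \<inter> ball (x m) (Min S / 2) = {}"
      using le by (intro disjoint_ballI) auto
  qed (use M in auto)
qed

context enumerated_poisson_process
begin

text \<open>
  The qualitative form of the multivariate Mecke equation. Distinct points have disjoint
  neighbourhoods from a countable base, so the tuples of distinct points are covered by countably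
  many boxes with disjoint sides of finite measure, and on each box the moment measure is the
  product measure.
\<close>

theorem distinct_tuples_null_iff:
  assumes B: "B \<in> sets (PiM {..<k} (\<lambda>_. \<mu>))" "\<And>x. x \<in> B \<Longrightarrow> inj_on x {..<k}"
  shows "emeasure (PiM {..<k} (\<lambda>_. \<mu>)) B = 0 \<longleftrightarrow> (\<forall>i\<in>indices k. AE \<omega> in P. tuple k i \<omega> \<notin> B)"
proof -
  let ?M = "PiM {..<k} (\<lambda>_. \<mu>)"
  obtain \<B> :: "'a set set" where \<B>: "countable \<B>" "topological_basis \<B>"
    using ex_countable_basis by blast
  obtain F :: "nat \<Rightarrow> 'a set" where F: "range F \<subseteq> sets \<mu>" "(\<Union>n. F n) = space \<mu>" "\<And>n. emeasure \<mu> (F n) \<noteq> \<infinity>"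
    using \<mu>.sigma_finite by blast
  \<comment> \<open>Intersecting the base with the \<open>F n\<close> makes the sides of the boxes finite.\<close>
  define \<V> where "\<V> = (\<lambda>(C, n). C \<inter> F n) ` (\<B> \<times> UNIV)"
  define \<U> where "\<U> = {U \<in> PiE {..<k} (\<lambda>_. \<V>). disjoint_family_on U {..<k}}"
  have "countable \<V>" unfolding \<V>_def using \<B>(1) by (intro countable_image countable_SIGMA) auto
  then have count: "countable \<U>"
    unfolding \<U>_def by (intro countable_subset[OF _ countable_PiE[of "{..<k}" "\<lambda>_. \<V>"]]) auto
  have \<V>: "V \<in> sets borel \<and> emeasure \<mu> V < \<infinity>" if V: "V \<in> \<V>" for V
  proof -
    obtain C n where Cn: "C \<in> \<B>" "V = C \<inter> F n" using V by (auto simp: \<V>_def)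
    have "C \<in> sets borel" using topological_basis_open[OF \<B>(2) Cn(1)] by auto
    moreover have "F n \<in> sets borel" using F(1) by (auto simp: sets_\<mu>)
    moreover have "emeasure \<mu> V \<le> emeasure \<mu> (F n)"
      using F(1) Cn(2) by (intro emeasure_mono) auto
    ultimately show ?thesis using Cn(2) F(3)[of n] by (auto simp: less_top top_unique)
  qed
  have cover: "\<exists>U\<in>\<U>. x \<in> PiE {..<k} U" if x: "x \<in> B" for x
  proof -
    obtain e where e: "e > 0" "\<forall>l\<in>{..<k}. \<forall>m\<in>{..<k}. l \<noteq> m \<longrightarrow> ball (x l) e \<inter> ball (x m) e = {}"
      using disjoint_balls_of_inj[of "{..<k}" x] B(2)[OF x] by auto
    have "\<exists>C\<in>\<B>. x l \<in> C \<and> C \<subseteq> ball (x l) e" for l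
      using topological_basisE[OF \<B>(2), of "ball (x l) e" "x l"] e(1) by (metis centre_in_ball open_ball)
    then obtain C where C: "\<And>l. C l \<in> \<B>" "\<And>l. x l \<in> C l" "\<And>l. C l \<subseteq> ball (x l) e" by metis
    have "\<exists>n. x l \<in> F n" for l using F(2) by auto
    then obtain n where n: "\<And>l. x l \<in> F (n l)" by metis
    define U where "U = (\<lambda>l\<in>{..<k}. C l \<inter> F (n l))"
    have "U \<in> PiE {..<k} (\<lambda>_. \<V>)" using C(1) by (auto simp: U_def \<V>_def)
    moreover have "disjoint_family_on U {..<k}"
      using e(2) C(3) unfolding disjoint_family_on_def U_def by (auto; blast)
    moreover have "x \<in> extensional {..<k}"
      using sets.sets_into_space[OF B(1)] x by (auto simp: space_PiM PiE_iff)
    ultimately show ?thesis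
      using C(2) n by (intro bexI[of _ U]) (auto simp: \<U>_def U_def PiE_iff)
  qed
  have Us: "PiE {..<k} U \<in> sets ?M" if "U \<in> \<U>" for U
    using that \<V> by (intro sets_PiM_I_finite) (auto simp: \<U>_def sets_\<mu>)
  have null: "emeasure N B = 0 \<longleftrightarrow> (\<forall>U\<in>\<U>. emeasure N (B \<inter> PiE {..<k} U) = 0)" if N: "sets N = sets ?M" for N
  proof
    assume "emeasure N B = 0"
    then have "B \<in> null_sets N" using B(1) N by auto
    then show "\<forall>U\<in>\<U>. emeasure N (B \<inter> PiE {..<k} U) = 0"
      using null_set_Int2[of B N] Us N by (blast dest: null_setsD1)
  next
    assume "\<forall>U\<in>\<U>. emeasure N (B \<inter> PiE {..<k} U) = 0"
    then have "(\<Union>U\<in>\<U>. B \<inter> PiE {..<k} U) \<in> null_sets N"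
      using Us N B(1) by (intro null_sets_UN' count) (auto simp: null_sets_def)
    moreover have "(\<Union>U\<in>\<U>. B \<inter> PiE {..<k} U) = B" using cover by blast
    ultimately show "emeasure N B = 0" by auto
  qed
  have "emeasure (tuple_measure k) (B \<inter> PiE {..<k} U) = emeasure ?M (B \<inter> PiE {..<k} U)" if U: "U \<in> \<U>" for U
    using U \<V> B(1) Us[OF U] by (intro tuple_measure_eq_on_disjoint_box[of k U]) (auto simp: \<U>_def PiE_iff)
  then have "emeasure ?M B = 0 \<longleftrightarrow> emeasure (tuple_measure k) B = 0"
    by (simp add: null)
  then show ?thesis using tuple_measure_null_iff[OF B(1)] by simp
qed

lemma points_avoid_null:
  assumes N: "N \<in> null_sets \<mu>"
  shows "AE \<omega> in P. \<forall>i. X i \<omega> \<notin> N"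
proof -
  have N': "N \<in> sets borel" "emeasure \<mu> N = 0" using N by (auto simp: null_sets_def sets_\<mu>)
  have "(\<lambda>\<omega>. emeasure (dirac_sum X \<omega>) N) \<in> borel_measurable P"
    using poisson N' unfolding poisson_process_def by (simp add: sets_\<mu>)
  moreover have "(\<integral>\<^sup>+\<omega>. emeasure (dirac_sum X \<omega>) N \<partial>P) = 0"
    using expected_count[OF N'(1)] N'(2) by simp
  ultimately have "AE \<omega> in P. emeasure (dirac_sum X \<omega>) N = 0"
    by (subst (asm) nn_integral_0_iff_AE)
  then show ?thesis
  proof eventually_elim
    case (elim \<omega>)
    then have "AE i in count_space UNIV. indicator N (X i \<omega>) = (0::ennreal)"
      unfolding emeasure_dirac_sum[OF N'(1)] by (subst (asm) nn_integral_0_iff_AE) auto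
    then show ?case by (simp add: AE_count_space indicator_eq_0_iff)
  qed
qed

text \<open>
  Pairs of indices that stand for the same point have to be excluded here. In a graph without loops
  they are never joined.
\<close>

lemma pairs_avoid_null:
  assumes meas: "Measurable.pred (\<mu> \<Otimes>\<^sub>M \<mu>) (\<lambda>s. R (fst s) (snd s))"
    and null: "AE z in \<mu>. AE w in \<mu>. \<not> R z w"
  shows "AE \<omega> in P. \<forall>i j. X i \<omega> \<noteq> X j \<omega> \<longrightarrow> \<not> R (X i \<omega>) (X j \<omega>)"
proof -
  interpret product_\<mu>: product_sigma_finite "\<lambda>_::nat. \<mu>" by (rule product_sigma_finite_\<mu>)
  interpret \<mu>\<mu>: pair_sigma_finite \<mu> \<mu> ..
  let ?M = "PiM {..<2::nat} (\<lambda>_. \<mu>)"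
  have two: "{..<2::nat} = {0, 1}" by auto
  have coord: "(\<lambda>x. x l) \<in> ?M \<rightarrow>\<^sub>M \<mu>" if "l < 2" for l
    using that by (intro measurable_component_singleton) auto
  define B where "B = {x \<in> space ?M. R (x 0) (x 1) \<and> x 0 \<noteq> x 1}"
  have [measurable]: "Measurable.pred ?M (\<lambda>x. R (x 0) (x 1))"
    using measurable_compose[OF measurable_Pair[OF coord coord] meas, of 0 1] by simp
  have [measurable]: "(\<lambda>x. x l) \<in> ?M \<rightarrow>\<^sub>M borel" if "l < 2" for l
    using coord[OF that] by (simp add: measurable_cong_sets[OF refl sets_\<mu>])
  have "{x \<in> space ?M. x 0 = x 1} \<in> sets ?M"
    by (intro measurable_equality_set) measurable
  then have [measurable]: "Measurable.pred ?M (\<lambda>x. x 0 = x 1)" by (simp add: pred_def)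
  have B: "B \<in> sets ?M" unfolding B_def by measurable
  have inj: "inj_on x {..<2}" if "x \<in> B" for x
    using that by (auto simp: B_def two)
  have meas': "(\<lambda>s. indicator {s. R (fst s) (snd s)} s :: ennreal) \<in> borel_measurable (\<mu> \<Otimes>\<^sub>M \<mu>)"
  proof (rule borel_measurable_indicator)
    show "{s. R (fst s) (snd s)} \<in> sets (\<mu> \<Otimes>\<^sub>M \<mu>)"
      using meas by (simp add: pred_def space_pair_measure)
  qed
  have "emeasure ?M B = (\<integral>\<^sup>+x. indicator B x \<partial>?M)"
    using B by simp
  also have "\<dots> \<le> (\<integral>\<^sup>+x. indicator {s. R (fst s) (snd s)} (x 0, x 1) \<partial>?M)"
    by (intro nn_integral_mono) (auto simp: B_def indicator_def)
  also have "\<dots> = (\<integral>\<^sup>+s. indicator {s. R (fst s) (snd s)} (fst s, snd s) \<partial>(\<mu> \<Otimes>\<^sub>M \<mu>))"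
    unfolding two using meas'
    by (intro product_\<mu>.product_nn_integral_pair[where f="\<lambda>z w. indicator {s. R (fst s) (snd s)} (z, w)"])
       (auto simp: split_beta')
  also have "\<dots> = (\<integral>\<^sup>+z. \<integral>\<^sup>+w. indicator {s. R (fst s) (snd s)} (z, w) \<partial>\<mu> \<partial>\<mu>)"
    using meas' by (subst \<mu>.nn_integral_fst) auto
  also have "\<dots> = (\<integral>\<^sup>+z. 0 \<partial>\<mu>)"
  proof (rule nn_integral_cong_AE, use null in eventually_elim)
    case (elim z)
    have "(\<integral>\<^sup>+w. indicator {s. R (fst s) (snd s)} (z, w) \<partial>\<mu>) = (\<integral>\<^sup>+w. 0 \<partial>\<mu>)"
      by (rule nn_integral_cong_AE, use elim in eventually_elim) (simp add: indicator_def)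
    then show ?case by simp
  qed
  finally have "emeasure ?M B = 0" by simp
  then have avoid: "AE \<omega> in P. tuple 2 i \<omega> \<notin> B" if "i \<in> indices 2" for i
    using distinct_tuples_null_iff[OF B inj] that by blast
  have "AE \<omega> in P. X i \<omega> \<noteq> X j \<omega> \<longrightarrow> \<not> R (X i \<omega>) (X j \<omega>)" for i j
  proof -
    have "AE \<omega> in P. tuple 2 (\<lambda>l\<in>{..<2}. if l = 0 then i else j) \<omega> \<notin> B"
      by (rule avoid) auto
    then show ?thesis
      by eventually_elim (auto simp: B_def tuple_def space_PiM)
  qed
  then show ?thesis unfolding AE_all_countable by blast
qed

end

section \<open>Edges and paths in a random connection model\<close>

locale rcm = prob_space P
  for P :: "'w measure" and \<phi> :: "'a::{second_countable_topology, metric_space} \<Rightarrow> 'a \<Rightarrow> real" and Y :: "nat \<Rightarrow> 'w \<Rightarrow> 'a"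
    and \<xi> :: "'w \<Rightarrow> ('a \<times> 'a) set" +
  assumes model: "random_connection_model P \<phi> Y \<xi>"
    and measurable_\<phi>: "(\<lambda>(z, w). \<phi> z w) \<in> borel_measurable (borel \<Otimes>\<^sub>M borel)"
    and \<phi>_nonneg: "\<And>z w. 0 \<le> \<phi> z w" and \<phi>_le_1: "\<And>z w. \<phi> z w \<le> 1"
    and \<phi>_sym: "\<And>z w. \<phi> z w = \<phi> w z"
begin

lemma measurable_Y [measurable]: "Y i \<in> P \<rightarrow>\<^sub>M borel"
  and edge_sym: "\<omega> \<in> space P \<Longrightarrow> (z, w) \<in> \<xi> \<omega> \<longleftrightarrow> (w, z) \<in> \<xi> \<omega>"
  and edge_irrefl: "\<omega> \<in> space P \<Longrightarrow> (z, z) \<notin> \<xi> \<omega>"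
  and edge_vertices: "\<omega> \<in> space P \<Longrightarrow> \<xi> \<omega> \<subseteq> range (\<lambda>i. Y i \<omega>) \<times> range (\<lambda>i. Y i \<omega>)"
  and measurable_edge [measurable]: "{\<omega> \<in> space P. (Y i \<omega>, Y j \<omega>) \<in> \<xi> \<omega>} \<in> sets P"
proof -
  note m = model[unfolded random_connection_model_def]
  note graph = m[THEN conjunct2, THEN conjunct1]
  show "Y i \<in> P \<rightarrow>\<^sub>M borel"
    by (rule m[THEN conjunct1, THEN spec])
  show "{\<omega> \<in> space P. (Y i \<omega>, Y j \<omega>) \<in> \<xi> \<omega>} \<in> sets P"
    by (rule m[THEN conjunct2, THEN conjunct2, THEN conjunct1, THEN spec, THEN spec])
  assume \<omega>: "\<omega> \<in> space P"
  show "(z, w) \<in> \<xi> \<omega> \<longleftrightarrow> (w, z) \<in> \<xi> \<omega>"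
    using bspec[OF graph \<omega>] by (metis symD)
  show "(z, z) \<notin> \<xi> \<omega>" and "\<xi> \<omega> \<subseteq> range (\<lambda>i. Y i \<omega>) \<times> range (\<lambda>i. Y i \<omega>)"
    using bspec[OF graph \<omega>] by (auto simp only: irrefl_def)
qed

text \<open>
  The conditioning in the model is on all vertices at once, that is, on this sub-sigma-algebra.
\<close>

definition G :: "'w measure" where
  "G = vimage_algebra (space P) (\<lambda>\<omega> i. Y i \<omega>) (\<Pi>\<^sub>M i\<in>UNIV. borel)"

lemma space_G [simp]: "space G = space P"
  by (simp add: G_def)

lemma measurable_Y_G: "Y i \<in> G \<rightarrow>\<^sub>M borel"
proof -
  have "(\<lambda>\<omega> i. Y i \<omega>) \<in> G \<rightarrow>\<^sub>M (\<Pi>\<^sub>M i\<in>UNIV. borel)"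
    unfolding G_def by (rule measurable_vimage_algebra1) (simp add: space_PiM)
  from measurable_compose[OF this measurable_component_singleton[of i]] show ?thesis by simp
qed

lemma measurable_\<phi>_Y_G: "(\<lambda>\<omega>. \<phi> (Y i \<omega>) (Y j \<omega>)) \<in> borel_measurable G"
  using measurable_compose[OF measurable_Pair[OF measurable_Y_G measurable_Y_G] measurable_\<phi>]
  unfolding prod.case .

lemma measurable_\<phi>_Y [measurable]: "(\<lambda>\<omega>. \<phi> (Y i \<omega>) (Y j \<omega>)) \<in> borel_measurable P"
  using measurable_compose[OF measurable_Pair[OF measurable_Y measurable_Y] measurable_\<phi>]
  unfolding prod.case .

lemma subalgebra_G: "subalgebra P G"
  unfolding subalgebra_def
proof
  show "sets G \<subseteq> sets P"
    unfolding G_def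
    by (rule sets_image_in_sets) (auto intro!: measurable_PiM_single')
qed simp

text \<open>
  The conditional probability of the edges integrated over an event \<open>D\<close> determined by the vertices. With
  \<open>D\<close> the event that some factor vanishes this rules out edges of probability zero, and with \<open>D\<close> the
  whole space it gives a positive probability.
\<close>

lemma prob_edges:
  assumes F: "finite F" "F \<subseteq> {(i, j). i < j}" and D: "D \<in> sets G"
  shows "prob {\<omega> \<in> D. \<forall>(i, j)\<in>F. (Y i \<omega>, Y j \<omega>) \<in> \<xi> \<omega>} =
    (\<integral>\<omega>. indicator D \<omega> * (\<Prod>(i, j)\<in>F. \<phi> (Y i \<omega>) (Y j \<omega>)) \<partial>P)"
proof -
  interpret finite_measure_subalgebra P G
    by unfold_locales (rule subalgebra_G)
  define J where "J = {\<omega> \<in> space P. \<forall>(i, j)\<in>F. (Y i \<omega>, Y j \<omega>) \<in> \<xi> \<omega>}"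
  have J': "J = {\<omega> \<in> space P. \<forall>(i, j)\<in>F. (Y i \<omega>, Y j \<omega>) \<in> \<xi> \<omega> \<longleftrightarrow> (i, j) \<in> F}"
    by (auto simp: J_def)
  have J [measurable]: "J \<in> sets P"
  proof -
    have "J = {\<omega> \<in> space P. \<forall>e\<in>F. (Y (fst e) \<omega>, Y (snd e) \<omega>) \<in> \<xi> \<omega>}"
      by (auto simp: J_def)
    also have "\<dots> \<in> sets P"
      using F(1) by (intro sets.sets_Collect_finite_All measurable_edge)
    finally show ?thesis .
  qed
  have D' [measurable]: "D \<in> sets P" using D subalgebra_G by (auto simp: subalgebra_def)
  have ce: "AE \<omega> in P. real_cond_exp P G (indicator J) \<omega> = (\<Prod>(i, j)\<in>F. \<phi> (Y i \<omega>) (Y j \<omega>))"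
    using model F unfolding random_connection_model_def G_def[symmetric] J' by (force dest: spec[of _ F])
  have "{\<omega> \<in> D. \<forall>(i, j)\<in>F. (Y i \<omega>, Y j \<omega>) \<in> \<xi> \<omega>} = D \<inter> J"
    using sets.sets_into_space[OF D'] by (auto simp: J_def)
  then have "prob {\<omega> \<in> D. \<forall>(i, j)\<in>F. (Y i \<omega>, Y j \<omega>) \<in> \<xi> \<omega>} = (\<integral>\<omega>. indicator (D \<inter> J) \<omega> \<partial>P)"
    by simp
  also have "\<dots> = (\<integral>\<omega>\<in>D. indicator J \<omega> \<partial>P)"
    unfolding set_lebesgue_integral_def by (simp add: indicator_inter_arith)
  also have "\<dots> = (\<integral>\<omega>\<in>D. real_cond_exp P G (indicator J) \<omega> \<partial>P)"
    by (rule real_cond_exp_intA[OF _ D]) (rule integrable_const_bound[of _ 1], auto)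
  also have "\<dots> = (\<integral>\<omega>. indicator D \<omega> * (\<Prod>(i, j)\<in>F. \<phi> (Y i \<omega>) (Y j \<omega>)) \<partial>P)"
    unfolding set_lebesgue_integral_def
  proof (rule integral_cong_AE)
    show "(\<lambda>\<omega>. indicator D \<omega> * (\<Prod>(i, j)\<in>F. \<phi> (Y i \<omega>) (Y j \<omega>))) \<in> borel_measurable P"
      unfolding split_beta' by measurable
  qed (use ce in \<open>auto elim!: eventually_mono\<close>)
  finally show ?thesis .
qed

lemma edge_positive_ordered:
  assumes "i < j"
  shows "AE \<omega> in P. (Y i \<omega>, Y j \<omega>) \<in> \<xi> \<omega> \<longrightarrow> \<phi> (Y i \<omega>) (Y j \<omega>) > 0"
proof -
  define D where "D = {\<omega> \<in> space G. \<phi> (Y i \<omega>) (Y j \<omega>) = 0}"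
  have D: "D \<in> sets G"
    unfolding D_def using measurable_\<phi>_Y_G by measurable
  have D' [measurable]: "D \<in> sets P" using D subalgebra_G by (auto simp: subalgebra_def)
  have "prob {\<omega> \<in> D. \<forall>(i, j)\<in>{(i, j)}. (Y i \<omega>, Y j \<omega>) \<in> \<xi> \<omega>} =
    (\<integral>\<omega>. indicator D \<omega> * (\<Prod>(i, j)\<in>{(i, j)}. \<phi> (Y i \<omega>) (Y j \<omega>)) \<partial>P)"
    using assms by (intro prob_edges D) auto
  also have "\<dots> = 0"
    by (intro integral_eq_zero_AE AE_I2) (auto simp: D_def indicator_def)
  finally have "prob (D \<inter> {\<omega> \<in> space P. (Y i \<omega>, Y j \<omega>) \<in> \<xi> \<omega>}) = 0"
    by (rule back_subst[of "\<lambda>A. prob A = 0"]) (auto simp: D_def)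
  then have "AE \<omega> in P. \<omega> \<notin> D \<inter> {\<omega> \<in> space P. (Y i \<omega>, Y j \<omega>) \<in> \<xi> \<omega>}"
    by (intro AE_not_in) (auto simp: null_sets_def emeasure_eq_measure)
  then show ?thesis
    using AE_space by eventually_elim (use \<phi>_nonneg in \<open>auto simp: D_def less_le\<close>)
qed

lemma edges_positive:
  "AE \<omega> in P. \<forall>z w. (z, w) \<in> \<xi> \<omega> \<longrightarrow> \<phi> z w > 0"
proof -
  have "AE \<omega> in P. \<forall>i j. i < j \<longrightarrow> (Y i \<omega>, Y j \<omega>) \<in> \<xi> \<omega> \<longrightarrow> \<phi> (Y i \<omega>) (Y j \<omega>) > 0"
    unfolding AE_all_countable using edge_positive_ordered by (auto intro!: AE_impI)
  then show ?thesis
    using AE_space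
  proof eventually_elim
    case (elim \<omega>)
    show ?case
    proof (intro allI impI)
      fix z w assume zw: "(z, w) \<in> \<xi> \<omega>"
      obtain i j where ij: "z = Y i \<omega>" "w = Y j \<omega>" using edge_vertices[OF elim(2)] zw by auto
      have "i \<noteq> j" using edge_irrefl[OF elim(2)] zw ij by auto
      then consider "i < j" | "j < i" by linarith
      then show "\<phi> z w > 0"
      proof cases
        case 1
        then show ?thesis using elim(1) zw ij by auto
      next
        case 2
        have "(w, z) \<in> \<xi> \<omega>" using zw edge_sym[OF elim(2)] by blast
        then have "\<phi> w z > 0" using elim(1) ij 2 by auto
        then show ?thesis using \<phi>_sym[of z w] by simp
      qed
    qed
  qed
qed

text \<open>
  The model prescribes conditional probabilities for ordered pairs, so the pairs in \<open>E\<close> are ordered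
  first; by symmetry this changes neither event. The conditional probability is then a finite product
  that is positive wherever all its factors are.
\<close>

lemma edges_probable:
  assumes E: "finite E" "\<And>i j. (i, j) \<in> E \<Longrightarrow> i \<noteq> j"
    and pos: "\<not> (AE \<omega> in P. \<not> (\<forall>(i, j)\<in>E. \<phi> (Y i \<omega>) (Y j \<omega>) > 0))"
  shows "prob {\<omega> \<in> space P. \<forall>(i, j)\<in>E. (Y i \<omega>, Y j \<omega>) \<in> \<xi> \<omega>} > 0"
proof -
  define F where "F = (\<lambda>(i, j). (min i j, max i j)) ` E"
  have F: "finite F" "F \<subseteq> {(i, j). i < j}" using E(1) by (auto simp: F_def min_def max_def less_le dest: E(2) split: if_splits)
  have E_F: "(\<forall>(i, j)\<in>E. R i j) \<longleftrightarrow> (\<forall>(i, j)\<in>F. R i j)" if "\<And>i j. R i j \<longleftrightarrow> R j i" for R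
  proof -
    have "R (min i j) (max i j) \<longleftrightarrow> R i j" for i j
      using that[of i j] by (auto simp: min_def max_def)
    then show ?thesis unfolding F_def by fastforce
  qed
  let ?f = "\<lambda>\<omega>. \<Prod>(i, j)\<in>F. \<phi> (Y i \<omega>) (Y j \<omega>)"
  have meas: "?f \<in> borel_measurable P"
    unfolding split_beta' by measurable
  have bounds: "0 \<le> ?f \<omega>" "?f \<omega> \<le> 1" for \<omega>
    using \<phi>_nonneg \<phi>_le_1 by (auto intro!: prod_nonneg prod_le_1)
  have "integrable P ?f"
    using meas bounds by (intro integrable_const_bound[of _ 1]) auto
  moreover have "\<not> (AE \<omega> in P. ?f \<omega> = 0)"
  proof
    assume "AE \<omega> in P. ?f \<omega> = 0"
    then have "AE \<omega> in P. \<not> (\<forall>(i, j)\<in>E. \<phi> (Y i \<omega>) (Y j \<omega>) > 0)"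
    proof eventually_elim
      case (elim \<omega>)
      show ?case
        using elim F(1) by (subst E_F) (auto simp: \<phi>_sym, force)
    qed
    then show False using pos by simp
  qed
  ultimately have nz: "(\<integral>\<omega>. ?f \<omega> \<partial>P) \<noteq> 0"
    using bounds by (subst integral_nonneg_eq_0_iff_AE) auto
  have f_F: "(\<integral>\<omega>. ?f \<omega> \<partial>P) = prob {\<omega> \<in> space P. \<forall>(i, j)\<in>F. (Y i \<omega>, Y j \<omega>) \<in> \<xi> \<omega>}"
    using prob_edges[OF F sets.top] by (simp cong: Bochner_Integration.integral_cong)
  have F_E: "{\<omega> \<in> space P. \<forall>(i, j)\<in>F. (Y i \<omega>, Y j \<omega>) \<in> \<xi> \<omega>} = {\<omega> \<in> space P. \<forall>(i, j)\<in>E. (Y i \<omega>, Y j \<omega>) \<in> \<xi> \<omega>}"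
    by (intro Collect_cong conj_cong refl E_F[symmetric]) (rule edge_sym)
  show ?thesis
    using nz unfolding f_F F_E zero_less_measure_iff .
qed

text \<open>
  A path can be described by indices, of which there are countably many, because all its vertices
  belong to the enumeration.
\<close>

lemma measurable_connected [measurable]: "{\<omega> \<in> space P. (Y i \<omega>, Y j \<omega>) \<in> (\<xi> \<omega>)\<^sup>*} \<in> sets P"
proof -
  have "{\<omega> \<in> space P. (Y i \<omega>, Y j \<omega>) \<in> \<xi> \<omega> ^^ n} \<in> sets P" for n
  proof (induction n arbitrary: j)
    case 0
    have "{\<omega> \<in> space P. Y i \<omega> = Y j \<omega>} \<in> sets P" by measurable
    then show ?case by simp
  next
    case (Suc n)
    have "{\<omega> \<in> space P. (Y i \<omega>, Y j \<omega>) \<in> \<xi> \<omega> ^^ Suc n} =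
        {\<omega> \<in> space P. \<exists>m. (Y i \<omega>, Y m \<omega>) \<in> \<xi> \<omega> ^^ n \<and> (Y m \<omega>, Y j \<omega>) \<in> \<xi> \<omega>}"
      using edge_vertices by auto
    also have "\<dots> \<in> sets P"
      by (intro sets.sets_Collect_countable_Ex sets.sets_Collect_conj Suc measurable_edge)
    finally show ?case .
  qed
  then have "{\<omega> \<in> space P. \<exists>n. (Y i \<omega>, Y j \<omega>) \<in> \<xi> \<omega> ^^ n} \<in> sets P"
    by (intro sets.sets_Collect_countable_Ex)
  then show ?thesis by (simp add: rtrancl_power)
qed

end

section \<open>Connection probabilities and irreducibility\<close>

text \<open>
  For a diffuse measure the last coordinate almost surely avoids the finitely many others.
\<close>

lemma AE_PiM_inj_on:
  fixes \<mu> :: "'a::{second_countable_topology, metric_space} measure"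
  assumes sigma: "sigma_finite_measure \<mu>" and sets [measurable_cong]: "sets \<mu> = sets borel"
    and diffuse: "\<And>z. emeasure \<mu> {z} = 0"
  shows "AE x in PiM {..<k::nat} (\<lambda>_. \<mu>). inj_on x {..<k}"
proof (induction k)
  case (Suc k)
  interpret product_sigma_finite "\<lambda>_::nat. \<mu>"
    unfolding product_sigma_finite_def using sigma by simp
  have meas [measurable]: "Measurable.pred (PiM {..<n} (\<lambda>_. \<mu>)) (\<lambda>x. inj_on x {..<n})" for n :: nat
  proof -
    have "Measurable.pred (PiM {..<n} (\<lambda>_. \<mu>)) (\<lambda>x. x l = x m)" if "l < n" "m < n" for l m
    proof -
      have [measurable]: "(\<lambda>x. x i) \<in> PiM {..<n} (\<lambda>_. \<mu>) \<rightarrow>\<^sub>M borel" if "i < n" for i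
        using that measurable_component_singleton[of i "{..<n}" "\<lambda>_. \<mu>"]
        by (simp add: measurable_cong_sets[OF refl sets])
      show ?thesis unfolding pred_def using that by measurable
    qed
    then have "Measurable.pred (PiM {..<n} (\<lambda>_. \<mu>)) (\<lambda>x. \<forall>l\<in>{..<n}. \<forall>m\<in>{..<n}. x l = x m \<longrightarrow> l = m)"
      by (intro pred_intros_finite pred_intros_logic) auto
    then show ?thesis by (simp add: inj_on_def)
  qed
  have ins: "{..<Suc k} = insert k {..<k}" by (auto simp: less_Suc_eq)
  let ?N = "\<lambda>x. (if inj_on x {..<Suc k} then 0 else 1 :: ennreal)"
  have inner: "(\<integral>\<^sup>+y. ?N (x(k := y)) \<partial>\<mu>) = 0" if "inj_on x {..<k}" for x :: "nat \<Rightarrow> 'a"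
  proof -
    have "(\<Union>y\<in>x ` {..<k}. {y}) \<in> null_sets \<mu>"
      using diffuse sets by (intro null_sets_UN') (auto simp: null_sets_def countable_finite)
    then have "AE y in \<mu>. y \<notin> x ` {..<k}"
      by (rule AE_not_in[THEN eventually_mono]) auto
    then have "AE y in \<mu>. ?N (x(k := y)) = 0"
      by eventually_elim (use that in \<open>auto simp: ins inj_on_def\<close>)
    then show ?thesis by (simp cong: nn_integral_cong_AE)
  qed
  have "(\<integral>\<^sup>+x. ?N x \<partial>PiM {..<Suc k} (\<lambda>_. \<mu>)) = (\<integral>\<^sup>+x. \<integral>\<^sup>+y. ?N (x(k := y)) \<partial>\<mu> \<partial>PiM {..<k} (\<lambda>_. \<mu>))"
    unfolding ins by (rule product_nn_integral_insert) (auto simp: ins[symmetric])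
  also have "\<dots> = (\<integral>\<^sup>+x. 0 \<partial>PiM {..<k} (\<lambda>_. \<mu>))"
    using Suc by (intro nn_integral_cong_AE) (auto elim!: eventually_mono simp: inner)
  finally have "(\<integral>\<^sup>+x. ?N x \<partial>PiM {..<Suc k} (\<lambda>_. \<mu>)) = 0" by simp
  then have "AE x in PiM {..<Suc k} (\<lambda>_. \<mu>). ?N x = 0"
    by (subst (asm) nn_integral_0_iff_AE) auto
  then show ?case by eventually_elim (simp split: if_splits)
qed simp

text \<open>
  The product of \<open>\<phi>\<close> along the path from \<open>z\<close> through \<open>x 0, ..., x (k - 1)\<close> to \<open>w\<close>, so that its
  \<open>\<lambda>\<close>-integral over the intermediate points is the connection power of order \<open>k + 1\<close>.
\<close>

primrec chain :: "('a \<Rightarrow> 'a \<Rightarrow> real) \<Rightarrow> 'a \<Rightarrow> nat \<Rightarrow> (nat \<Rightarrow> 'a) \<Rightarrow> 'a \<Rightarrow> real" where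
  "chain \<phi> z 0 x w = \<phi> z w"
| "chain \<phi> z (Suc k) x w = chain \<phi> z k x (x k) * \<phi> (x k) w"

lemma chain_cong: "(\<And>l. l < k \<Longrightarrow> x l = y l) \<Longrightarrow> chain \<phi> z k x w = chain \<phi> z k y w"
  by (induction k arbitrary: w) auto

text \<open>
  The pairs of indices along the same path, which runs from index 0 through \<open>i 0, ..., i (k - 1)\<close> to \<open>j\<close>.
  When two points \<open>z1\<close> and \<open>z2\<close> are added to the process, they have the indices 0 and 1, and the point \<open>n\<close>
  of the process has index \<open>n + 2\<close>.
\<close>

primrec path_edges :: "nat \<Rightarrow> (nat \<Rightarrow> nat) \<Rightarrow> nat \<Rightarrow> (nat \<times> nat) set" where
  "path_edges 0 i j = {(0, j)}"
| "path_edges (Suc k) i j = insert (i k, j) (path_edges k i (i k))"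

lemma finite_path_edges: "finite (path_edges k i j)"
  by (induction k arbitrary: j) auto

lemma path_edges_distinct:
  assumes "inj_on i {..<k}" "\<And>l. l < k \<Longrightarrow> i l \<noteq> 0" "\<And>l. l < k \<Longrightarrow> i l \<noteq> j" "j \<noteq> 0"
    and "(a, b) \<in> path_edges k i j"
  shows "a \<noteq> b"
  using assms
proof (induction k arbitrary: j)
  case (Suc k)
  have "inj_on i {..<k}" using Suc.prems(1) by (rule inj_on_subset) auto
  moreover have "i l \<noteq> i k" if "l < k" for l
    using Suc.prems(1) that by (auto simp: inj_on_def)
  ultimately show ?case
    using Suc.IH[of "i k"] Suc.prems(2-5) by (auto simp: less_Suc_eq)
qed auto

lemma path_edges_chain:
  assumes nonneg: "\<And>z w. 0 \<le> \<phi> z w" and pos: "chain \<phi> (y 0) k (\<lambda>l. y (i l)) (y j) > 0"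
  shows "\<forall>(a, b)\<in>path_edges k i j. \<phi> (y a) (y b) > 0"
  using pos
proof (induction k arbitrary: j)
  case (Suc k)
  have "chain \<phi> z k x w \<ge> 0" for z x w
    using nonneg by (induction k arbitrary: w) auto
  then have "chain \<phi> (y 0) k (\<lambda>l. y (i l)) (y (i k)) > 0 \<and> \<phi> (y (i k)) (y j) > 0"
    using Suc.prems nonneg[of "y (i k)" "y j"] by (auto simp: less_le)
  then show ?case using Suc.IH[of "i k"] by auto
qed simp

lemma path_edges_connect:
  assumes "\<forall>(a, b)\<in>path_edges k i j. (y a, y b) \<in> E"
  shows "(y 0, y j) \<in> E\<^sup>*"
  using assms
proof (induction k arbitrary: j)
  case (Suc k)
  have "(y 0, y (i k)) \<in> E\<^sup>*" using Suc.prems by (intro Suc.IH) auto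
  moreover have "(y (i k), y j) \<in> E" using Suc.prems by auto
  ultimately show ?case by (rule rtrancl_into_rtrancl)
qed auto

locale poisson_rcm = marked_connection Q \<phi> + prob_space P
  for P :: "'w measure" and Q :: "'m::polish_space measure"
    and \<phi> :: "(real ^ 'd) \<times> 'm \<Rightarrow> (real ^ 'd) \<times> 'm \<Rightarrow> real" +
  fixes t :: real and X :: "nat \<Rightarrow> 'w \<Rightarrow> (real ^ 'd) \<times> 'm"
    and \<Xi> :: "(real ^ 'd) \<times> 'm \<Rightarrow> (real ^ 'd) \<times> 'm \<Rightarrow>
              'w \<Rightarrow> (((real ^ 'd) \<times> 'm) \<times> ((real ^ 'd) \<times> 'm)) set"
  assumes t: "t > 0"
    and X: "\<And>i. X i \<in> P \<rightarrow>\<^sub>M borel"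
    and poisson: "poisson_process P (scale_measure (ennreal t) (marked_lebesgue Q)) (dirac_sum X)"
    and model: "z1 \<noteq> z2 \<Longrightarrow> random_connection_model P \<phi> (add_points z1 z2 X) (\<Xi> z1 z2)"
begin

definition \<mu> :: "((real ^ 'd) \<times> 'm) measure" where "\<mu> = scale_measure (ennreal t) L"

lemma sets_\<mu> [measurable_cong]: "sets \<mu> = sets borel"
  by (simp add: \<mu>_def sets_L)

lemma AE_\<mu>_iff: "(AE z in \<mu>. R z) \<longleftrightarrow> (AE z in L. R z)"
  using t unfolding eventually_ae_filter \<mu>_def
  by (auto simp: null_sets_def space_scale_measure)

lemma sigma_finite_\<mu>: "sigma_finite_measure \<mu>"
proof
  obtain F :: "nat \<Rightarrow> _ set" where F: "range F \<subseteq> sets L" "(\<Union>n. F n) = space L" "\<And>n. emeasure L (F n) \<noteq> \<infinity>"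
    using L.sigma_finite by blast
  then show "\<exists>A. countable A \<and> A \<subseteq> sets \<mu> \<and> \<Union>A = space \<mu> \<and> (\<forall>a\<in>A. emeasure \<mu> a \<noteq> \<infinity>)"
    by (intro exI[of _ "range F"])
       (auto simp: \<mu>_def space_scale_measure ennreal_mult_eq_top_iff)
qed

sublocale points: enumerated_poisson_process P \<mu> X
proof (intro_locales)
  show "sigma_finite_measure \<mu>" by (rule sigma_finite_\<mu>)
  show "enumerated_poisson_process_axioms P \<mu> X"
    using X poisson by unfold_locales (simp_all add: sets_\<mu>, simp add: \<mu>_def L_def)
qed

lemma diffuse_\<mu>: "emeasure \<mu> {z} = 0"
proof -
  have "emeasure L ({fst z} \<times> {snd z}) = emeasure lborel {fst z} * emeasure Q {snd z}"
    unfolding L_def by (intro Q.emeasure_pair_measure_Times) (auto simp: sets_Q)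
  then show ?thesis by (simp add: \<mu>_def)
qed

lemma measurable_chain [measurable]:
  assumes "\<And>l. l < k \<Longrightarrow> (\<lambda>s. f s l) \<in> M \<rightarrow>\<^sub>M borel" "g \<in> M \<rightarrow>\<^sub>M borel"
  shows "(\<lambda>s. chain \<phi> z k (f s) (g s)) \<in> borel_measurable M"
  using assms
proof (induction k arbitrary: g)
  case 0
  then show ?case by simp
next
  case (Suc k)
  have [measurable]: "(\<lambda>s. f s k) \<in> M \<rightarrow>\<^sub>M borel" "g \<in> M \<rightarrow>\<^sub>M borel" using Suc.prems by auto
  have [measurable]: "(\<lambda>s. chain \<phi> z k (f s) (f s k)) \<in> borel_measurable M"
    using Suc.prems by (intro Suc.IH) auto
  show ?case by simp
qed

lemma chain_nonneg: "0 \<le> chain \<phi> z k x w"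
  using conn_nonneg by (induction k arbitrary: w) auto

lemma measurable_chain_PiM [measurable]:
  assumes "g \<in> PiM {..<k} (\<lambda>_. \<mu>) \<rightarrow>\<^sub>M borel"
  shows "(\<lambda>x. chain \<phi> z k x (g x)) \<in> borel_measurable (PiM {..<k} (\<lambda>_. \<mu>))"
proof (rule measurable_chain[OF _ assms])
  fix l assume "l < k"
  then show "(\<lambda>x. x l) \<in> PiM {..<k} (\<lambda>_. \<mu>) \<rightarrow>\<^sub>M borel"
    using measurable_component_singleton[of l "{..<k}" "\<lambda>_. \<mu>"]
    by (simp add: measurable_cong_sets[OF refl sets_\<mu>])
qed

lemma nn_integral_chain:
  "(\<integral>\<^sup>+x. ennreal (chain \<phi> z k x w) \<partial>PiM {..<k} (\<lambda>_. \<mu>)) = ennreal t ^ k * cpow (Suc k) z w"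
proof (induction k arbitrary: w)
  case 0
  show ?case by (simp add: space_PiM PiM_empty)
next
  case (Suc k)
  interpret product_sigma_finite "\<lambda>_::nat. \<mu>" by (rule points.product_sigma_finite_\<mu>)
  have ins: "{..<Suc k} = insert k {..<k}" by (auto simp: less_Suc_eq)
  have "(\<integral>\<^sup>+x. ennreal (chain \<phi> z (Suc k) x w) \<partial>PiM {..<Suc k} (\<lambda>_. \<mu>))
      = (\<integral>\<^sup>+y. \<integral>\<^sup>+x. ennreal (chain \<phi> z (Suc k) (x(k := y)) w) \<partial>PiM {..<k} (\<lambda>_. \<mu>) \<partial>\<mu>)"
    unfolding ins
    by (rule product_nn_integral_insert_rev)
       (use measurable_chain_PiM[of "\<lambda>_. w" "Suc k" z] in \<open>auto simp: ins[symmetric] simp del: chain.simps\<close>)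
  also have "\<dots> = (\<integral>\<^sup>+y. \<integral>\<^sup>+x. ennreal (chain \<phi> z k x y) * ennreal (\<phi> y w) \<partial>PiM {..<k} (\<lambda>_. \<mu>) \<partial>\<mu>)"
  proof (intro nn_integral_cong)
    fix x y
    have "chain \<phi> z k (x(k := y)) y = chain \<phi> z k x y" by (rule chain_cong) auto
    then show "ennreal (chain \<phi> z (Suc k) (x(k := y)) w) = ennreal (chain \<phi> z k x y) * ennreal (\<phi> y w)"
      by (simp add: ennreal_mult chain_nonneg conn_nonneg)
  qed
  also have "\<dots> = (\<integral>\<^sup>+y. ennreal t ^ k * (cpow (Suc k) z y * ennreal (\<phi> y w)) \<partial>\<mu>)"
    by (intro nn_integral_cong) (simp add: nn_integral_multc Suc mult.assoc del: conn_pow.simps)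
  also have "\<dots> = ennreal t * (\<integral>\<^sup>+y. ennreal t ^ k * (cpow (Suc k) z y * ennreal (\<phi> y w)) \<partial>L)"
    unfolding \<mu>_def by (rule nn_integral_scale_measure) measurable
  also have "\<dots> = ennreal t ^ Suc k * cpow (Suc (Suc k)) z w"
    unfolding cpow_Suc_Suc by (subst nn_integral_cmult) (simp_all add: mult.assoc del: conn_pow.simps)
  finally show ?case .
qed

lemma rcm_added:
  assumes "z1 \<noteq> z2"
  shows "rcm P \<phi> (add_points z1 z2 X) (\<Xi> z1 z2)"
proof (intro_locales)
  have "(\<lambda>s. \<phi> (fst s) (snd s)) \<in> borel_measurable (borel \<Otimes>\<^sub>M borel)" by measurable
  then show "rcm_axioms P \<phi> (add_points z1 z2 X) (\<Xi> z1 z2)"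
    using model[OF assms] conn_nonneg conn_le_1 conn_sym
    by (intro rcm_axioms.intro) (auto simp: split_beta')
qed

lemma add_points_simps [simp]:
  "add_points z1 z2 X 0 \<omega> = z1" "add_points z1 z2 X (Suc 0) \<omega> = z2"
  "add_points z1 z2 X (Suc (Suc n)) \<omega> = X n \<omega>"
  by (simp_all add: add_points_def)

text \<open>
  Some tuple of process points makes all factors of a connection power positive, with positive
  probability. Its points can be taken distinct, so no pair along the path repeats a vertex and the
  edges are all present with positive conditional probability.
\<close>

lemma connected_if_linked:
  assumes neq: "z1 \<noteq> z2" and linked: "linked z1 z2"
  shows "prob {\<omega> \<in> space P. (z1, z2) \<in> (\<Xi> z1 z2 \<omega>)\<^sup>*} > 0"
proof -
  interpret R: rcm P \<phi> "add_points z1 z2 X" "\<Xi> z1 z2" by (rule rcm_added[OF neq])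
  let ?Y = "add_points z1 z2 X"
  obtain k where k: "cpow (Suc k) z1 z2 > 0" using linked by (auto simp: linked_def)
  let ?M = "PiM {..<k} (\<lambda>_. \<mu>)"
  have [measurable]: "Measurable.pred ?M (\<lambda>x. chain \<phi> z1 k x z2 > 0)" by measurable
  obtain N where N: "N \<in> null_sets ?M" "\<And>x. x \<in> space ?M - N \<Longrightarrow> inj_on x {..<k}"
    using AE_PiM_inj_on[OF sigma_finite_\<mu> sets_\<mu> diffuse_\<mu>, of k] by (auto elim!: AE_E3)
  define B where "B = {x \<in> space ?M. chain \<phi> z1 k x z2 > 0} - N"
  have B [measurable]: "B \<in> sets ?M" using N(1) by (auto simp: B_def)
  have "(\<integral>\<^sup>+x. ennreal (chain \<phi> z1 k x z2) \<partial>?M) \<noteq> 0"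
    unfolding nn_integral_chain using k t by (simp del: conn_pow.simps)
  then have "\<not> (AE x in ?M. \<not> chain \<phi> z1 k x z2 > 0)"
    by (subst (asm) nn_integral_0_iff_AE) (auto simp: ennreal_eq_0_iff not_less)
  moreover have "AE x in ?M. \<not> chain \<phi> z1 k x z2 > 0" if "emeasure ?M B = 0"
  proof -
    have "AE x in ?M. x \<notin> B" using that B by (intro AE_not_in) auto
    moreover have "AE x in ?M. x \<notin> N" using N(1) by (rule AE_not_in)
    ultimately show ?thesis using AE_space by eventually_elim (auto simp: B_def)
  qed
  ultimately have "emeasure ?M B \<noteq> 0" by blast
  then obtain i where i: "\<not> (AE \<omega> in P. points.tuple k i \<omega> \<notin> B)"
    using points.distinct_tuples_null_iff[OF B] N(2) by (auto simp: B_def)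
  define j where "j l = Suc (Suc (i l))" for l
  define E where "E = path_edges k j 1"
  have tuple_B: "inj_on i {..<k} \<and> (\<forall>(a, b)\<in>E. \<phi> (?Y a \<omega>) (?Y b \<omega>) > 0)"
    if "points.tuple k i \<omega> \<in> B" for \<omega>
  proof
    have "inj_on (points.tuple k i \<omega>) {..<k}" using that N(2) by (auto simp: B_def)
    then show "inj_on i {..<k}" by (auto simp: points.tuple_def inj_on_def)
    have "chain \<phi> z1 k (points.tuple k i \<omega>) z2 = chain \<phi> (?Y 0 \<omega>) k (\<lambda>l. ?Y (j l) \<omega>) (?Y 1 \<omega>)"
      unfolding One_nat_def add_points_simps j_def by (rule chain_cong) (simp add: points.tuple_def)
    then have "chain \<phi> (?Y 0 \<omega>) k (\<lambda>l. ?Y (j l) \<omega>) (?Y 1 \<omega>) > 0"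
      using that by (auto simp: B_def)
    then show "\<forall>(a, b)\<in>E. \<phi> (?Y a \<omega>) (?Y b \<omega>) > 0"
      unfolding E_def by (intro path_edges_chain conn_nonneg)
  qed
  have "inj_on i {..<k}" using i tuple_B by (metis (no_types, lifting) AE_I2)
  then have inj_j: "inj_on j {..<k}" by (auto simp: j_def inj_on_def)
  have E_neq: "a \<noteq> b" if ab: "(a, b) \<in> E" for a b
    by (rule path_edges_distinct[OF inj_j _ _ _ ab[unfolded E_def]]) (auto simp: j_def)
  have "\<not> (AE \<omega> in P. \<not> (\<forall>(a, b)\<in>E. \<phi> (?Y a \<omega>) (?Y b \<omega>) > 0))"
  proof
    assume "AE \<omega> in P. \<not> (\<forall>(a, b)\<in>E. \<phi> (?Y a \<omega>) (?Y b \<omega>) > 0)"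
    then have "AE \<omega> in P. points.tuple k i \<omega> \<notin> B" by eventually_elim (use tuple_B in blast)
    then show False using i by blast
  qed
  then have "prob {\<omega> \<in> space P. \<forall>(a, b)\<in>E. (?Y a \<omega>, ?Y b \<omega>) \<in> \<Xi> z1 z2 \<omega>} > 0"
    by (intro R.edges_probable E_neq) (simp_all add: E_def finite_path_edges)
  also have "prob {\<omega> \<in> space P. \<forall>(a, b)\<in>E. (?Y a \<omega>, ?Y b \<omega>) \<in> \<Xi> z1 z2 \<omega>}
      \<le> prob {\<omega> \<in> space P. (?Y 0 \<omega>, ?Y 1 \<omega>) \<in> (\<Xi> z1 z2 \<omega>)\<^sup>*}"
    by (intro finite_measure_mono R.measurable_connected)
       (auto simp only: E_def intro: path_edges_connect[where y="\<lambda>a. ?Y a _"])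
  finally show ?thesis by simp
qed

text \<open>
  Edges occur only where \<open>\<phi>\<close> is positive. On a path from \<open>z1\<close>, each edge leads to \<open>z1\<close> or to a point
  linked to \<open>z1\<close>, except when it joins an exceptional pair of points of the process, or a process point
  to \<open>z2\<close> across an exceptional set; both exceptions are null and hence almost surely do not occur.
\<close>

lemma disconnected_if_unlinked:
  assumes neq: "z1 \<noteq> z2" and unlinked: "\<not> linked z1 z2"
  shows "prob {\<omega> \<in> space P. (z1, z2) \<in> (\<Xi> z1 z2 \<omega>)\<^sup>*} = 0"
proof -
  interpret R: rcm P \<phi> "add_points z1 z2 X" "\<Xi> z1 z2" by (rule rcm_added[OF neq])
  have edge_linked: "linked z w" if "\<phi> z w > 0" for z w
    using that by (auto simp: linked_def intro!: exI[of _ 0])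
  have unlinked_step: "AE u in L. \<not> (linked z1 u \<and> \<phi> u w > 0)" if "\<not> linked z1 w" for w
    using linked_trans_AE[of z1 w] by eventually_elim (use that edge_linked in blast)
  have last: "AE \<omega> in P. \<forall>i. \<not> (linked z1 (X i \<omega>) \<and> \<phi> (X i \<omega>) z2 > 0)"
  proof -
    have "{u. linked z1 u \<and> \<phi> u z2 > 0} \<in> sets borel"
    proof -
      have "Measurable.pred borel (\<lambda>u. linked z1 u \<and> \<phi> u z2 > 0)" by measurable
      then show ?thesis by (simp add: pred_def)
    qed
    moreover have "AE u in \<mu>. u \<notin> {u. linked z1 u \<and> \<phi> u z2 > 0}"
      unfolding AE_\<mu>_iff using unlinked_step[OF unlinked] by simp
    ultimately have "{u. linked z1 u \<and> \<phi> u z2 > 0} \<in> null_sets \<mu>"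
      by (subst AE_iff_null_sets) (simp_all add: sets_\<mu>)
    from points.points_avoid_null[OF this] show ?thesis by simp
  qed
  have leave: "AE \<omega> in P. \<forall>i j. X i \<omega> \<noteq> X j \<omega> \<longrightarrow>
      \<not> (linked z1 (X i \<omega>) \<and> \<not> linked z1 (X j \<omega>) \<and> \<phi> (X i \<omega>) (X j \<omega>) > 0)"
  proof -
    have "AE w in \<mu>. AE u in \<mu>. \<not> (linked z1 u \<and> \<not> linked z1 w \<and> \<phi> u w > 0)"
    proof (rule AE_I2)
      fix w
      show "AE u in \<mu>. \<not> (linked z1 u \<and> \<not> linked z1 w \<and> \<phi> u w > 0)"
        unfolding AE_\<mu>_iff
        by (cases "linked z1 w") (auto dest!: unlinked_step elim!: eventually_mono)
    qed
    from points.pairs_avoid_null[OF _ this] show ?thesis by auto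
  qed
  have "AE \<omega> in P. (z1, z2) \<notin> (\<Xi> z1 z2 \<omega>)\<^sup>*"
    using last leave R.edges_positive AE_space
  proof eventually_elim
    case (elim \<omega>)
    have "v = z1 \<or> linked z1 v \<and> v \<in> range (\<lambda>i. X i \<omega>)" if "(z1, v) \<in> (\<Xi> z1 z2 \<omega>)\<^sup>*" for v
      using that
    proof (induction rule: rtrancl_induct)
      case (step v w)
      have vw: "\<phi> v w > 0" "v \<noteq> w" using elim(3) R.edge_irrefl[OF elim(4)] step.hyps(2) by blast+
      obtain n where n: "w = add_points z1 z2 X n \<omega>"
        using R.edge_vertices[OF elim(4)] step.hyps(2) by auto
      consider "w = z1" | "w = z2" | m where "w = X m \<omega>"
        using n by (cases n; cases "n - 1") auto
      then show ?case
      proof cases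
        case 2
        then show ?thesis using step.IH vw elim(1) unlinked edge_linked by blast
      next
        case (3 m)
        then show ?thesis using step.IH vw elim(2) edge_linked by blast
      qed auto
    qed simp
    then show ?case using neq unlinked by blast
  qed
  then have "prob {\<omega> \<in> space P. (z1, z2) \<in> (\<Xi> z1 z2 \<omega>)\<^sup>*} = prob {}"
    using R.measurable_connected[of 0 1] by (intro measure_eq_AE) (auto simp del: measure_empty)
  then show ?thesis by simp
qed

lemma irreducible_iff_AE_linked:
  "irreducible_rcm P Q \<Xi> \<longleftrightarrow> (AE (z1, z2) in L \<Otimes>\<^sub>M L. linked z1 z2)"
proof -
  have iff: "measure P {\<omega>\<in>space P. (z1, z2) \<in> (\<Xi> z1 z2 \<omega>)\<^sup>*} > 0 \<longleftrightarrow> linked z1 z2" if "z1 \<noteq> z2" for z1 z2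
    using connected_if_linked[OF that] disconnected_if_unlinked[OF that] by force
  have "AE z1 in L. AE z2 in L. z1 \<noteq> z2"
  proof (rule AE_I2)
    fix z1
    have "AE z2 in \<mu>. z2 \<notin> {z1}"
      using diffuse_\<mu> by (intro AE_not_in) (auto simp: null_sets_def sets_\<mu>)
    then show "AE z2 in L. z1 \<noteq> z2"
      unfolding AE_\<mu>_iff by eventually_elim auto
  qed
  then have "AE s in L \<Otimes>\<^sub>M L. fst s \<noteq> snd s"
  proof (intro LL.AE_pair_measure)
    have "{s \<in> space (L \<Otimes>\<^sub>M L). fst s = snd s} \<in> sets (L \<Otimes>\<^sub>M L)" by measurable
    then have [measurable]: "Measurable.pred (L \<Otimes>\<^sub>M L) (\<lambda>s. fst s = snd s)" by (simp add: pred_def)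
    show "{s \<in> space (L \<Otimes>\<^sub>M L). fst s \<noteq> snd s} \<in> sets (L \<Otimes>\<^sub>M L)" by measurable
  qed simp
  note neq = this
  have "(AE (z1, z2) in L \<Otimes>\<^sub>M L. measure P {\<omega>\<in>space P. (z1, z2) \<in> (\<Xi> z1 z2 \<omega>)\<^sup>*} > 0) \<longleftrightarrow>
      (AE (z1, z2) in L \<Otimes>\<^sub>M L. linked z1 z2)" (is "(AE s in _. ?A s) \<longleftrightarrow> (AE s in _. ?B s)")
  proof
    assume "AE s in L \<Otimes>\<^sub>M L. ?A s"
    with neq show "AE s in L \<Otimes>\<^sub>M L. ?B s"
    proof eventually_elim
      case (elim s)
      then show ?case using iff[of "fst s" "snd s"] by (simp add: split_beta')
    qed
  next
    assume "AE s in L \<Otimes>\<^sub>M L. ?B s"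
    with neq show "AE s in L \<Otimes>\<^sub>M L. ?A s"
    proof eventually_elim
      case (elim s)
      then show ?case using iff[of "fst s" "snd s"] by (simp add: split_beta')
    qed
  qed
  then show ?thesis unfolding irreducible_rcm_def L_def .
qed

end

theorem theorem5p7:
  fixes P :: "'w measure"
    and t :: real
    and Q :: "'m::polish_space measure"
    and \<phi> :: "(real ^ 'd) \<times> 'm \<Rightarrow> (real ^ 'd) \<times> 'm \<Rightarrow> real"
    and X :: "nat \<Rightarrow> 'w \<Rightarrow> (real ^ 'd) \<times> 'm"
    and \<xi> :: "'w \<Rightarrow> (((real ^ 'd) \<times> 'm) \<times> ((real ^ 'd) \<times> 'm)) set"
    and \<Xi> :: "(real ^ 'd) \<times> 'm \<Rightarrow> (real ^ 'd) \<times> 'm \<Rightarrow>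
              'w \<Rightarrow> (((real ^ 'd) \<times> 'm) \<times> ((real ^ 'd) \<times> 'm)) set"
  assumes "t > 0"
    and "stationary_marked_rcm P t Q \<phi> X \<xi> \<Xi>"
  shows "irreducible_rcm P Q \<Xi> \<longleftrightarrow>
           (AE (p, q) in Q \<Otimes>\<^sub>M Q. (SUP n\<in>{1..}. d_conn Q \<phi> n p q) > 0)"
proof -
  note model = assms(2)[unfolded stationary_marked_rcm_def]
  note tail = model[THEN conjunct2, THEN conjunct2, THEN conjunct2]
  have X: "X i \<in> P \<rightarrow>\<^sub>M borel" for i
    using tail[THEN conjunct2, THEN conjunct2, THEN conjunct1]
    unfolding random_connection_model_def by (elim conjE allE)
  interpret poisson_rcm P Q \<phi> t X \<Xi>
  proof (intro poisson_rcm.intro marked_connection.intro poisson_rcm_axioms.intro)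
    show "prob_space P" by (rule model[THEN conjunct1])
    show "prob_space Q" by (rule model[THEN conjunct2, THEN conjunct1])
    show "sets Q = sets borel" by (rule model[THEN conjunct2, THEN conjunct2, THEN conjunct1])
    show "connection_function Q \<phi>" by (rule tail[THEN conjunct1])
    show "poisson_process P (scale_measure (ennreal t) (marked_lebesgue Q)) (dirac_sum X)"
      by (rule tail[THEN conjunct2, THEN conjunct1])
    show "random_connection_model P \<phi> (add_points z1 z2 X) (\<Xi> z1 z2)" if "z1 \<noteq> z2" for z1 z2
      using tail[THEN conjunct2, THEN conjunct2, THEN conjunct2] that by blast
  qed (rule assms(1) X)+
  show ?thesis
    unfolding d_conn_pos_iff AE_linked_iff[symmetric] by (rule irreducible_iff_AE_linked)
qed

end
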